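(* Let $d,n\ge1$, $k\ge0$, and let $\Sigma\in\mathbb{R}^{d\times d}$ be positive definite. Let $x^{(1)},\dots,x^{(n+1)}$ be i.i.d. $\mathcal{N}(0,\Sigma)$, $w_\star\sim\mathcal{N}(0,\Sigma^{-1})$ independent, and $y^{(i)}=\langle x^{(i)},w_\star\rangle$ for $i\le n$. Let $$Z_0=\begin{bmatrix} x^{(1)} & \cdots & x^{(n)} & x^{(n+1)}\\ y^{(1)} & \cdots & y^{(n)} & 0\end{bmatrix},\qquad M=\begin{bmatrix} I_n & 0\\ 0& 0\end{bmatrix}\in\mathbb{R}^{(n+1)\times(n+1)}.$$ For $A=\{A_i\}_{i=0}^k$, $B=\{B_i\}_{i=0}^k$ with $A_i,B_i\in\mathbb{R}^{d\times d}$ and each $A_i$ symmetric, set $P_i=\begin{bmatrix}B_i&0\\0&1\end{bmatrix}$, $Q_i=\begin{bmatrix}A_i&0\\0&0\end{bmatrix}$, $Z_{i+1}=Z_i+\frac1nP_iZ_iM(Z_i^\top Q_iZ_i)$ for $i=0,\dots,k$, and $$f(A,B)=\mathbb{E}\Big[\big([Z_{k+1}]_{d+1,n+1}+w_\star^\top x^{(n+1)}\big)^2\Big].$$ Let $\mathcal{S}$ be the set of pairs $(A,B)$ such that for every $i\in\{0,\dots,k\}$ there are scalars $a_i,b_i\in\mathbb{R}$ with $A_i=a_i\Sigma^{-1}$ and $B_i=b_iI_d$. Then $$\inf_{(A,B)\in\mathcal{S}}\sum_{i=0}^k\Big(\|\nabla_{A_i}f(A,B)\|_F^2+\|\nabla_{B_i}f(A,B)\|_F^2\Big)=0,$$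 where $\nabla_{A_i}f$, $\nabla_{B_i}f$ denote gradients with respect to the matrices $A_i$, $B_i$ (Frobenius inner product).
   Context: $[X]_{i,j}$ denotes the $(i,j)$ entry of a matrix; $\|\cdot\|_F$ is the Frobenius norm. The expectation is over $x^{(1)},\dots,x^{(n+1)},w_\star$. *)

theory Defs
  imports "HOL-Probability.Probability" "Jordan_Normal_Form.Determinant"
begin

definition pos_def_mat :: "nat \<Rightarrow> real mat \<Rightarrow> bool" where
  "pos_def_mat d S \<longleftrightarrow> S \<in> carrier_mat d d \<and> S\<^sup>T = S \<and>
     (\<forall>v \<in> carrier_vec d. v \<noteq> 0\<^sub>v d \<longrightarrow> v \<bullet> (S *\<^sub>v v) > 0)"

definition mat_inv :: "nat \<Rightarrow> real mat \<Rightarrow> real mat" where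
  "mat_inv d S = (THE T. T \<in> carrier_mat d d \<and> S * T = 1\<^sub>m d)"

definition leb_d :: "nat \<Rightarrow> (nat \<Rightarrow> real) measure" where
  "leb_d d = PiM {..<d} (\<lambda>_. lborel)"

definition gauss_pdf :: "nat \<Rightarrow> real mat \<Rightarrow> (nat \<Rightarrow> real) \<Rightarrow> real" where
  "gauss_pdf d C v =
     exp (- (vec d v \<bullet> (mat_inv d C *\<^sub>v vec d v)) / 2) / sqrt ((2 * pi) ^ d * det C)"

definition mvnormal :: "nat \<Rightarrow> real mat \<Rightarrow> (nat \<Rightarrow> real) measure" where
  "mvnormal d C = density (leb_d d) (\<lambda>v. ennreal (gauss_pdf d C v))"

(* joint law of (x^(1),...,x^(n+1), w_star): x^(i) iid N(0,Sig), w_star ~ N(0,Sig^{-1}) independent.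
   A sample is (xs, w) with x^(i) = vec d (xs i) for i in {1..n+1}. *)
definition icl_law :: "nat \<Rightarrow> nat \<Rightarrow> real mat \<Rightarrow> ((nat \<Rightarrow> nat \<Rightarrow> real) \<times> (nat \<Rightarrow> real)) measure" where
  "icl_law d n Sig = (PiM {1..n+1} (\<lambda>_. mvnormal d Sig)) \<Otimes>\<^sub>M mvnormal d (mat_inv d Sig)"

definition Z0 :: "nat \<Rightarrow> nat \<Rightarrow> (nat \<Rightarrow> nat \<Rightarrow> real) \<Rightarrow> (nat \<Rightarrow> real) \<Rightarrow> real mat" where
  "Z0 d n xs w = mat (d+1) (n+1) (\<lambda>(r, c).
      if r < d then xs (c+1) r
      else if c < n then vec d (xs (c+1)) \<bullet> vec d w else 0)"

definition Mmask :: "nat \<Rightarrow> real mat" where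
  "Mmask n = four_block_mat (1\<^sub>m n) (0\<^sub>m n 1) (0\<^sub>m 1 n) (0\<^sub>m 1 1)"

definition Pmat :: "nat \<Rightarrow> real mat \<Rightarrow> real mat" where
  "Pmat d Bi = four_block_mat Bi (0\<^sub>m d 1) (0\<^sub>m 1 d) (1\<^sub>m 1)"

definition Qmat :: "nat \<Rightarrow> real mat \<Rightarrow> real mat" where
  "Qmat d Ai = four_block_mat Ai (0\<^sub>m d 1) (0\<^sub>m 1 d) (0\<^sub>m 1 1)"

fun Zseq :: "nat \<Rightarrow> nat \<Rightarrow> (nat \<Rightarrow> real mat) \<Rightarrow> (nat \<Rightarrow> real mat) \<Rightarrow>
              (nat \<Rightarrow> nat \<Rightarrow> real) \<Rightarrow> (nat \<Rightarrow> real) \<Rightarrow> nat \<Rightarrow> real mat" where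
  "Zseq d n A B xs w 0 = Z0 d n xs w"
| "Zseq d n A B xs w (Suc i) =
     (let Z = Zseq d n A B xs w i in
      Z + (1 / real n) \<cdot>\<^sub>m (Pmat d (B i) * Z * Mmask n * (Z\<^sup>T * Qmat d (A i) * Z)))"

(* f(A,B) = E[([Z_{k+1}]_{d+1,n+1} + w_star^T x^(n+1))^2]  (1-based entry (d+1,n+1) = 0-based (d,n)) *)
definition icl_loss :: "nat \<Rightarrow> nat \<Rightarrow> nat \<Rightarrow> real mat \<Rightarrow> (nat \<Rightarrow> real mat) \<Rightarrow> (nat \<Rightarrow> real mat) \<Rightarrow> real" where
  "icl_loss d n k Sig A B =
     (\<integral>\<omega>. (Zseq d n A B (fst \<omega>) (snd \<omega>) (Suc k) $$ (d, n)
            + vec d (snd \<omega>) \<bullet> vec d (fst \<omega> (n+1)))\<^sup>2 \<partial>icl_law d n Sig)"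

definition unit_entry :: "nat \<Rightarrow> nat \<Rightarrow> nat \<Rightarrow> real mat" where
  "unit_entry d r c = mat d d (\<lambda>(p, q). if p = r \<and> q = c then 1 else 0)"

definition mat_grad :: "nat \<Rightarrow> (real mat \<Rightarrow> real) \<Rightarrow> real mat \<Rightarrow> real mat" where
  "mat_grad d F X = mat d d (\<lambda>(r, c). deriv (\<lambda>t. F (X + t \<cdot>\<^sub>m unit_entry d r c)) 0)"

definition frob_sq :: "real mat \<Rightarrow> real" where
  "frob_sq G = (\<Sum>r<dim_row G. \<Sum>c<dim_col G. (G $$ (r, c))\<^sup>2)"

end

theory Submission
  imports Defs
begin

text \<open>
  Write \<open>\<Sigma> = G G\<^sup>T\<close> with \<open>G\<close> upper triangular (Cholesky). The substitution \<open>x = G u\<close>,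
  \<open>w = G\<^sup>-\<^sup>T v\<close> turns \<open>f(A, B)\<close> into the loss for \<open>\<Sigma> = I\<close> at
  \<open>(G\<^sup>T A\<^sub>i G, G\<^sup>-\<^sup>1 B\<^sub>i G)\<close>, which sends the subspace in question to the scalar matrices
  \<open>(a\<^sub>i I, b\<^sub>i I)\<close>. The loss for \<open>\<Sigma> = I\<close> is invariant under simultaneous conjugation by signed
  permutation matrices; scalar matrices are fixed by it, so there every block of the gradient is
  itself a scalar matrix. Hence the full gradient is controlled by the partial derivatives of the
  restriction \<open>F(a, b)\<close>. This \<open>F\<close> is a nonnegative polynomial, and the minimizer of
  \<open>F + \<delta> |(a, b)|\<^sup>2\<close> satisfies \<open>|\<nabla>F|\<^sup>2 = 4 \<delta>\<^sup>2 |(a, b)|\<^sup>2 \<le> 4 \<delta> F(0)\<close>, which tends to 0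
  with \<open>\<delta>\<close>.
\<close>

section \<open>Almost critical points and polynomial functions\<close>

text \<open>Nothing shows that \<open>F\<close> attains its infimum, so no critical point is at
  hand; the penalty supplies coercivity, and letting it fade gives only an infimum. The gradients
  involve all matrix entries, whereas \<open>F\<close> sees only scalar matrices. The bridge is that
  the derivative in each block is a linear functional of the direction, invariant under the
  symmetries: sign changes kill its off-diagonal coefficients and signed exchanges of two
  coordinates equate the diagonal ones. It is therefore \<open>g\<close> times the trace, and the
  identity direction shows that the matching partial derivative of \<open>F\<close> is
  \<open>d * g\<close>. The factor of the covariance is triangular because such a map is a
  composition of updates of one coordinate, each settled by Fubini and an affine substitution on the
  line. The weights have the inverse covariance and move by the inverse transpose, which preserves
  all inner products with the inputs, hence labels and target. Differentiability comes from the loss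
  being a polynomial in the parameters whose coefficients are combinations of Gaussian moments, so
  no derivative has to pass under an integral.\<close>

lemma approx_critical_point:
  fixes F :: "('i \<Rightarrow> real) \<Rightarrow> real" and D :: "('i \<Rightarrow> real) \<Rightarrow> 'i \<Rightarrow> real"
  assumes "finite I"
    and cont: "continuous_on UNIV F"
    and nonneg: "\<And>\<theta>. F \<theta> \<ge> 0"
    and deriv: "\<And>\<theta> i. i \<in> I \<Longrightarrow> ((\<lambda>t. F (\<theta>(i := \<theta> i + t))) has_real_derivative D \<theta> i) (at 0)"
    and "e > 0"
  shows "\<exists>\<theta>. (\<Sum>i\<in>I. (D \<theta> i)\<^sup>2) < e"
proof -
  define F0 where "F0 = F (\<lambda>_. 0)"
  have F0: "F0 \<ge> 0" using nonneg by (simp add: F0_def)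
  \<comment> \<open>Chosen so that the final bound \<open>4 * \<delta> * F0\<close> lies below
    \<open>e\<close>; the \<open>+ 1\<close> covers \<open>F0 = 0\<close>.\<close>
  define \<delta> where "\<delta> = e / (4 * (F0 + 1))"
  have \<delta>: "\<delta> > 0" using \<open>e > 0\<close> F0 by (simp add: \<delta>_def)
  \<comment> \<open>Once a single coordinate exceeds \<open>R\<close> in absolute value, the penalty
    alone reaches \<open>F0\<close>, the value of the penalized function at the origin.\<close>
  define R where "R = sqrt (F0 / \<delta>)"
  have R: "R \<ge> 0" "\<delta> * R\<^sup>2 = F0" using \<delta> F0 by (auto simp: R_def)
  define G where "G \<theta> = F \<theta> + \<delta> * (\<Sum>i\<in>I. (\<theta> i)\<^sup>2)" for \<theta>
  \<comment> \<open>The index type may be infinite. Pinning the coordinates outside \<open>I\<close>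
    at 0 makes \<open>K\<close> a product of compact sets, compact by Tychonoff; only coordinates in
    \<open>I\<close> are varied below.\<close>
  define K where "K = PiE UNIV (\<lambda>i. if i \<in> I then {-R..R} else {0})"
  have "compactin (product_topology (\<lambda>_. euclidean) UNIV) K"
    unfolding K_def compactin_PiE by auto
  then have K: "compact K" by (simp add: euclidean_product_topology)
  have 0: "(\<lambda>_. 0) \<in> K" using R by (auto simp: K_def)
  have "continuous_on UNIV G"
    unfolding G_def by (intro continuous_intros cont continuous_on_product_coordinates)
  then have "continuous_on K G" using continuous_on_subset by blast
  then obtain \<theta> where \<theta>: "\<theta> \<in> K" "\<And>\<eta>. \<eta> \<in> K \<Longrightarrow> G \<theta> \<le> G \<eta>"
    using continuous_attains_inf[OF K] 0 by blast
  have le: "G \<theta> \<le> F0" using \<theta>(2)[OF 0] by (simp add: G_def F0_def)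
  \<comment> \<open>The minimum over the box is a minimum along every full coordinate line: a point
    that leaves the box pays a penalty of at least \<open>F0\<close>, which already bounds
    \<open>G \<theta>\<close>.\<close>
  have glob: "G \<theta> \<le> G (\<theta>(i := \<theta> i + t))" if i: "i \<in> I" for i t
  proof (cases "\<bar>\<theta> i + t\<bar> \<le> R")
    case True
    then have "\<theta>(i := \<theta> i + t) \<in> K"
      using \<theta>(1) i unfolding K_def PiE_UNIV_domain by (auto simp: Pi_iff abs_le_iff split: if_splits)
    then show ?thesis by (rule \<theta>(2))
  next
    case False
    let ?\<eta> = "\<theta>(i := \<theta> i + t)"
    have "R\<^sup>2 \<le> (\<theta> i + t)\<^sup>2" using False R by (simp add: abs_le_square_iff[symmetric])
    also have "\<dots> \<le> (\<Sum>j\<in>I. (?\<eta> j)\<^sup>2)"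
      using member_le_sum[OF i, of "\<lambda>j. (?\<eta> j)\<^sup>2"] \<open>finite I\<close> by simp
    finally have "\<delta> * R\<^sup>2 \<le> \<delta> * (\<Sum>j\<in>I. (?\<eta> j)\<^sup>2)" using \<delta> by simp
    then show ?thesis using le R nonneg[of ?\<eta>] unfolding G_def by linarith
  qed
  have crit: "D \<theta> i = - 2 * \<delta> * \<theta> i" if i: "i \<in> I" for i
  proof -
    have "(\<Sum>j\<in>I. ((\<theta>(i := \<theta> i + t)) j)\<^sup>2) = (\<theta> i + t)\<^sup>2 + (\<Sum>j\<in>I-{i}. (\<theta> j)\<^sup>2)" for t
      using \<open>finite I\<close> i by (simp add: sum.remove)
    then have eq: "(\<lambda>t. G (\<theta>(i := \<theta> i + t)))
        = (\<lambda>t. F (\<theta>(i := \<theta> i + t)) + \<delta> * ((\<theta> i + t)\<^sup>2 + (\<Sum>j\<in>I-{i}. (\<theta> j)\<^sup>2)))"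
      by (simp add: G_def)
    have "((\<lambda>t. G (\<theta>(i := \<theta> i + t))) has_real_derivative D \<theta> i + \<delta> * (2 * \<theta> i)) (at 0)"
      unfolding eq by (rule derivative_eq_intros deriv i refl | simp)+
    from DERIV_local_min[OF this, of 1] glob[OF i]
    show ?thesis by simp
  qed
  have "\<delta> * (\<Sum>i\<in>I. (\<theta> i)\<^sup>2) \<le> F0" using le nonneg[of \<theta>] by (simp add: G_def)
  then have "4 * \<delta> * (\<delta> * (\<Sum>i\<in>I. (\<theta> i)\<^sup>2)) \<le> 4 * \<delta> * F0" using \<delta> by (intro mult_left_mono) auto
  also have "\<dots> < e" using F0 \<open>e > 0\<close> by (simp add: \<delta>_def field_simps)
  finally have "4 * \<delta> * (\<delta> * (\<Sum>i\<in>I. (\<theta> i)\<^sup>2)) < e" .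
  moreover have "(\<Sum>i\<in>I. (D \<theta> i)\<^sup>2) = 4 * \<delta> * (\<delta> * (\<Sum>i\<in>I. (\<theta> i)\<^sup>2))"
    by (simp add: crit power_mult_distrib sum_distrib_left power2_eq_square mult.assoc mult.left_commute)
  ultimately have "(\<Sum>i\<in>I. (D \<theta> i)\<^sup>2) < e" by simp
  then show ?thesis by (rule exI[of _ \<theta>])
qed

text \<open>Polynomials are kept as functions generated from constants and coordinates, so
  continuity and differentiability follow by induction without tracking degrees or
  coefficients.\<close>

inductive poly_fun :: "'v set \<Rightarrow> (('v \<Rightarrow> real) \<Rightarrow> real) \<Rightarrow> bool" for V where
  const: "poly_fun V (\<lambda>_. c)"
| var: "v \<in> V \<Longrightarrow> poly_fun V (\<lambda>x. x v)"
| add: "poly_fun V p \<Longrightarrow> poly_fun V q \<Longrightarrow> poly_fun V (\<lambda>x. p x + q x)"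
| mult: "poly_fun V p \<Longrightarrow> poly_fun V q \<Longrightarrow> poly_fun V (\<lambda>x. p x * q x)"

lemma poly_fun_continuous: "poly_fun V p \<Longrightarrow> continuous_on UNIV p"
  by (induction rule: poly_fun.induct)
     (auto intro!: continuous_intros continuous_on_product_coordinates)

text \<open>The order of quantifiers matters: one \<open>D\<close>, the gradient at
  \<open>x\<close>, serves all directions \<open>e\<close>. This linearity later reduces a matrix
  direction to its entries.\<close>

lemma poly_fun_directional_derivative:
  assumes "poly_fun V p" "finite V"
  shows "\<exists>D. \<forall>e. ((\<lambda>t. p (\<lambda>v. x v + t * e v)) has_real_derivative (\<Sum>v\<in>V. D v * e v)) (at 0)"
  using assms(1)
proof induction
  case (const c)
  show ?case by (rule exI[of _ "\<lambda>_. 0"]) simp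
next
  case (var v)
  have "(\<Sum>w\<in>V. (if w = v then 1 else 0) * e w) = e v" for e :: "'a \<Rightarrow> real"
    using var \<open>finite V\<close> by (simp add: if_distrib[of "\<lambda>z. z * _"] cong: if_cong)
  then show ?case
    by (intro exI[of _ "\<lambda>w. if w = v then 1 else 0"] allI) (auto intro!: derivative_eq_intros)
next
  case (add p q)
  then obtain D E where
    "\<And>e. ((\<lambda>t. p (\<lambda>v. x v + t * e v)) has_real_derivative (\<Sum>v\<in>V. D v * e v)) (at 0)"
    "\<And>e. ((\<lambda>t. q (\<lambda>v. x v + t * e v)) has_real_derivative (\<Sum>v\<in>V. E v * e v)) (at 0)" by blast
  then show ?case
    by (intro exI[of _ "\<lambda>v. D v + E v"] allI)
       (auto intro!: derivative_eq_intros simp: sum.distrib distrib_right)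
next
  case (mult p q)
  then obtain D E where DE:
    "\<And>e. ((\<lambda>t. p (\<lambda>v. x v + t * e v)) has_real_derivative (\<Sum>v\<in>V. D v * e v)) (at 0)"
    "\<And>e. ((\<lambda>t. q (\<lambda>v. x v + t * e v)) has_real_derivative (\<Sum>v\<in>V. E v * e v)) (at 0)" by blast
  have "(\<Sum>v\<in>V. (D v * q x + E v * p x) * e v) = (\<Sum>v\<in>V. D v * e v) * q x + (\<Sum>v\<in>V. E v * e v) * p x" for e
    unfolding sum_distrib_right sum.distrib[symmetric] by (intro sum.cong) (auto simp: algebra_simps)
  then show ?case using DERIV_mult[OF DE]
    by (intro exI[of _ "\<lambda>v. D v * q x + E v * p x"] allI) simp
qed

section \<open>Cholesky factorization\<close>

text \<open>Elimination of the last index, which is what makes the factor upper triangular. With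
  entries given as a function on all of \<open>nat\<close>, passing to the leading block is just a
  smaller \<open>d\<close>.\<close>

lemma cholesky:
  fixes S :: "nat \<Rightarrow> nat \<Rightarrow> real"
  assumes "\<And>i j. i < d \<Longrightarrow> j < d \<Longrightarrow> S i j = S j i"
    and "\<And>v. \<exists>i<d. v i \<noteq> 0 \<Longrightarrow> (\<Sum>i<d. \<Sum>j<d. v i * S i j * v j) > 0"
  shows "\<exists>U. (\<forall>i<d. U i i > 0) \<and> (\<forall>i<d. \<forall>j<i. U i j = 0) \<and>
             (\<forall>i<d. \<forall>j<d. S i j = (\<Sum>m<d. U i m * U j m))"
  using assms
proof (induction d arbitrary: S)
  case 0
  show ?case by simp
next
  case (Suc d)
  note sym = Suc.prems(1) and pd = Suc.prems(2)
  define s where "s = S d d"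
  have s: "s > 0"
    using pd[of "\<lambda>i. if i = d then 1 else 0"] by (simp add: s_def)
  \<comment> \<open>The Schur complement of the pivot \<open>s\<close>.\<close>
  define S' where "S' i j = S i j - S i d * S j d / s" for i j
  have "\<exists>U. (\<forall>i<d. U i i > 0) \<and> (\<forall>i<d. \<forall>j<i. U i j = 0) \<and>
             (\<forall>i<d. \<forall>j<d. S' i j = (\<Sum>m<d. U i m * U j m))"
  proof (rule Suc.IH)
    show "S' i j = S' j i" if "i < d" "j < d" for i j
      using that sym[of i j] by (simp add: S'_def)
    fix v :: "nat \<Rightarrow> real"
    assume v: "\<exists>i<d. v i \<noteq> 0"
    define c where "c = (\<Sum>i<d. v i * S i d)"
    \<comment> \<open>The last coordinate \<open>- c / s\<close> minimizes the quadratic form of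
      \<open>S\<close> over all extensions of \<open>v\<close>; the minimum is the form of
      \<open>S'\<close> at \<open>v\<close>.\<close>
    define u where "u = (\<lambda>i. if i = d then - c / s else v i)"
    have "0 < (\<Sum>i<Suc d. \<Sum>j<Suc d. u i * S i j * u j)"
      using v by (intro pd) (auto simp: u_def)
    also have "\<dots> = (\<Sum>i<d. \<Sum>j<d. v i * S i j * v j) + (\<Sum>i<d. v i * S i d * (- c / s))
        + ((\<Sum>j<d. (- c / s) * S d j * v j) + (- c / s) * s * (- c / s))"
      by (simp add: u_def sum.distrib s_def sum_subtractf flip: sum_negf)
    also have "(\<Sum>i<d. v i * S i d * (- c / s)) = c * (- c / s)"
      by (simp only: c_def sum_distrib_right)
    also have "(\<Sum>j<d. (- c / s) * S d j * v j) = (\<Sum>j<d. (- c / s) * (v j * S j d))"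
      using sym by (intro sum.cong) auto
    also have "\<dots> = (- c / s) * c"
      by (simp only: c_def sum_distrib_left[symmetric])
    also have "(\<Sum>i<d. \<Sum>j<d. v i * S i j * v j) + c * (- c / s) + ((- c / s) * c + (- c / s) * s * (- c / s))
        = (\<Sum>i<d. \<Sum>j<d. v i * S i j * v j) - c * c / s"
      using s by (simp add: field_simps)
    also have "c * c / s = (\<Sum>i<d. \<Sum>j<d. v i * (S i d * S j d / s) * v j)"
      by (simp add: c_def sum_product sum_divide_distrib mult_ac)
    also have "(\<Sum>i<d. \<Sum>j<d. v i * S i j * v j) - \<dots> = (\<Sum>i<d. \<Sum>j<d. v i * S' i j * v j)"
      unfolding S'_def sum_subtractf[symmetric]
      by (intro sum.cong refl) (simp only: right_diff_distrib left_diff_distrib)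
    finally show "0 < (\<Sum>i<d. \<Sum>j<d. v i * S' i j * v j)" .
  qed
  then obtain U where U: "\<forall>i<d. U i i > 0" "\<forall>i<d. \<forall>j<i. U i j = 0"
    "\<forall>i<d. \<forall>j<d. S' i j = (\<Sum>m<d. U i m * U j m)" by (elim exE conjE)
  \<comment> \<open>The new last column contributes \<open>S i d * S j d / s\<close> to the product,
    exactly what was subtracted in \<open>S'\<close>; the rest of row \<open>d\<close> is
    zero.\<close>
  define V where "V i j = (if j = d then S i d / sqrt s else if i = d then 0 else U i j)" for i j
  have "S i j = (\<Sum>m<Suc d. V i m * V j m)" if ij: "i < Suc d" "j < Suc d" for i j
  proof -
    have "(\<Sum>m<Suc d. V i m * V j m) = (\<Sum>m<d. V i m * V j m) + S i d * S j d / s"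
      using s by (simp add: V_def)
    moreover have "(\<Sum>m<d. V i m * V j m) = S i j - S i d * S j d / s"
    proof (cases "i = d \<or> j = d")
      case True
      then have "(\<Sum>m<d. V i m * V j m) = 0" by (auto simp: V_def)
      then show ?thesis using True s sym[of d j] ij by (auto simp: s_def)
    next
      case False
      then have "(\<Sum>m<d. V i m * V j m) = (\<Sum>m<d. U i m * U j m)" by (intro sum.cong) (auto simp: V_def)
      then show ?thesis using U(3) False ij by (simp add: S'_def)
    qed
    ultimately show ?thesis by simp
  qed
  moreover have "V i i > 0" if "i < Suc d" for i
    using that U(1) s by (auto simp: V_def s_def[symmetric])
  moreover have "V i j = 0" if "i < Suc d" "j < i" for i j
    using that U(2) by (auto simp: V_def)
  ultimately show ?case by (intro exI[of _ V]) auto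
qed

section \<open>Linear changes of variables\<close>

text \<open>The constant \<open>c\<close> plays the role of the absolute Jacobian determinant.
  Taking the substitution formula for nonnegative functions as the definition makes the property
  multiply under composition.\<close>

definition leb_scales :: "nat \<Rightarrow> ((nat \<Rightarrow> real) \<Rightarrow> nat \<Rightarrow> real) \<Rightarrow> real \<Rightarrow> bool" where
  "leb_scales d T c \<longleftrightarrow> c > 0 \<and> T \<in> measurable (leb_d d) (leb_d d) \<and>
     (\<forall>f\<in>borel_measurable (leb_d d).
        (\<integral>\<^sup>+v. f v \<partial>leb_d d) = ennreal c * (\<integral>\<^sup>+v. f (T v) \<partial>leb_d d))"

lemma leb_scalesI:
  assumes "c > 0" "T \<in> measurable (leb_d d) (leb_d d)"
    "\<And>f. f \<in> borel_measurable (leb_d d) \<Longrightarrow>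
       (\<integral>\<^sup>+v. f v \<partial>leb_d d) = ennreal c * (\<integral>\<^sup>+v. f (T v) \<partial>leb_d d)"
  shows "leb_scales d T c"
  using assms unfolding leb_scales_def by blast

lemma leb_scalesD:
  assumes "leb_scales d T c"
  shows "c > 0" "T \<in> measurable (leb_d d) (leb_d d)"
    "f \<in> borel_measurable (leb_d d) \<Longrightarrow>
       (\<integral>\<^sup>+v. f v \<partial>leb_d d) = ennreal c * (\<integral>\<^sup>+v. f (T v) \<partial>leb_d d)"
  using assms unfolding leb_scales_def by blast+

lemma space_leb_d: "space (leb_d d) = extensional {..<d}"
  by (simp add: leb_d_def space_PiM PiE_def)

lemma measurable_leb_d_component [measurable]: "i < d \<Longrightarrow> (\<lambda>v. v i) \<in> borel_measurable (leb_d d)"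
  unfolding leb_d_def by measurable

lemma leb_scales_cong:
  assumes T: "leb_scales d T c" and eq: "\<And>v. v \<in> extensional {..<d} \<Longrightarrow> T v = T' v"
  shows "leb_scales d T' c"
proof (rule leb_scalesI)
  show "c > 0" by (rule leb_scalesD[OF T])
  have "T' \<in> measurable (leb_d d) (leb_d d) \<longleftrightarrow> T \<in> measurable (leb_d d) (leb_d d)"
    using eq by (intro measurable_cong) (simp add: space_leb_d)
  then show "T' \<in> measurable (leb_d d) (leb_d d)" using leb_scalesD(2)[OF T] by blast
  fix f :: "_ \<Rightarrow> ennreal"
  assume "f \<in> borel_measurable (leb_d d)"
  moreover have "(\<integral>\<^sup>+v. f (T v) \<partial>leb_d d) = (\<integral>\<^sup>+v. f (T' v) \<partial>leb_d d)"
    using eq by (intro nn_integral_cong) (simp add: space_leb_d)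
  ultimately show "(\<integral>\<^sup>+v. f v \<partial>leb_d d) = ennreal c * (\<integral>\<^sup>+v. f (T' v) \<partial>leb_d d)"
    using leb_scalesD(3)[OF T] by metis
qed

lemma leb_scales_comp:
  assumes T: "leb_scales d T c" and S: "leb_scales d S c'"
  shows "leb_scales d (\<lambda>v. S (T v)) (c * c')"
proof (rule leb_scalesI)
  note m [measurable] = leb_scalesD(2)[OF T] leb_scalesD(2)[OF S]
  have c: "c > 0" "c' > 0" using leb_scalesD(1) T S by blast+
  then show "c * c' > 0" by simp
  show "(\<lambda>v. S (T v)) \<in> measurable (leb_d d) (leb_d d)" by measurable
  fix f :: "_ \<Rightarrow> ennreal"
  assume f: "f \<in> borel_measurable (leb_d d)"
  have "(\<integral>\<^sup>+v. f v \<partial>leb_d d) = ennreal c' * (\<integral>\<^sup>+v. f (S v) \<partial>leb_d d)"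
    by (rule leb_scalesD(3)[OF S f])
  also have "(\<integral>\<^sup>+v. f (S v) \<partial>leb_d d) = ennreal c * (\<integral>\<^sup>+v. f (S (T v)) \<partial>leb_d d)"
    by (rule leb_scalesD(3)[OF T measurable_compose[OF m(2) f]])
  finally show "(\<integral>\<^sup>+v. f v \<partial>leb_d d) = ennreal (c * c') * (\<integral>\<^sup>+v. f (S (T v)) \<partial>leb_d d)"
    using c by (simp add: ennreal_mult' mult_ac)
qed

text \<open>Fubini isolates coordinate \<open>m\<close>. With the other coordinates fixed,
  \<open>g\<close> is a constant, and the map is an affine function of one real variable with slope
  \<open>a\<close>.\<close>

lemma leb_scales_update:
  assumes m: "m < d" and "a \<noteq> 0" and g [measurable]: "g \<in> borel_measurable (leb_d d)"
    and indep: "\<And>v t. v \<in> extensional {..<d} \<Longrightarrow> g (v(m := t)) = g v"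
  shows "leb_scales d (\<lambda>v. v(m := a * v m + g v)) \<bar>a\<bar>"
proof -
  interpret product_sigma_finite "\<lambda>_::nat. lborel :: real measure" ..
  let ?T = "\<lambda>v. v(m := a * v m + g v)"
  define I where "I = {..<d} - {m}"
  have I: "finite I" "m \<notin> I" "insert m I = {..<d}" using m by (auto simp: I_def)
  have leb: "leb_d d = PiM (insert m I) (\<lambda>_. lborel)" by (simp add: leb_d_def I)
  have T [measurable]: "?T \<in> measurable (leb_d d) (leb_d d)"
    unfolding leb_d_def
  proof (rule measurable_fun_upd[where J = "{..<d}"])
    have "(\<lambda>v. a * v m + g v) \<in> borel_measurable (leb_d d)"
      using m by measurable
    then show "(\<lambda>v. a * v m + g v) \<in> measurable (Pi\<^sub>M {..<d} (\<lambda>_. lborel)) lborel"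
      by (simp add: leb_d_def)
  qed (use m in auto)
  have *: "(\<integral>\<^sup>+v. f v \<partial>leb_d d) = ennreal \<bar>a\<bar> * (\<integral>\<^sup>+v. f (?T v) \<partial>leb_d d)"
    if f: "f \<in> borel_measurable (leb_d d)" for f
  proof -
    have fT: "(\<lambda>v. f (?T v)) \<in> borel_measurable (leb_d d)"
      using measurable_compose[OF T f] .
    have fm: "(\<lambda>y. h (x(m := y))) \<in> borel_measurable lborel"
      if "x \<in> space (PiM I (\<lambda>_. lborel))" "h \<in> borel_measurable (leb_d d)" for x and h :: "_ \<Rightarrow> ennreal"
      using measurable_comp[OF measurable_component_update[OF that(1) I(2)] that(2)[unfolded leb]]
      by (simp add: comp_def)
    have "ennreal \<bar>a\<bar> * (\<integral>\<^sup>+v. f (?T v) \<partial>leb_d d)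
        = (\<integral>\<^sup>+v. ennreal \<bar>a\<bar> * f (?T v) \<partial>leb_d d)"
      using fT by (simp add: nn_integral_cmult)
    also have "\<dots> = (\<integral>\<^sup>+x. (\<integral>\<^sup>+y. ennreal \<bar>a\<bar> * f (?T (x(m := y))) \<partial>lborel) \<partial>PiM I (\<lambda>_. lborel))"
      unfolding leb using fT by (intro product_nn_integral_insert I) (simp add: leb)
    also have "\<dots> = (\<integral>\<^sup>+x. (\<integral>\<^sup>+y. f (x(m := y)) \<partial>lborel) \<partial>PiM I (\<lambda>_. lborel))"
    proof (rule nn_integral_cong)
      fix x :: "nat \<Rightarrow> real"
      assume x: "x \<in> space (PiM I (\<lambda>_. lborel))"
      \<comment> \<open>The point \<open>x\<close> carries only the remaining coordinates. Filling
        in 0 at \<open>m\<close> gives a point of the full space at which \<open>g\<close> can be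
        evaluated; by \<open>indep\<close> any other value would give the same.\<close>
      then have x0: "x(m := 0) \<in> extensional {..<d}"
        using m by (auto simp: space_PiM PiE_def extensional_def I_def)
      have Tx: "?T (x(m := y)) = x(m := g (x(m := 0)) + a * y)" for y
        using indep[OF x0, of y] by (simp add: add.commute)
      have "(\<integral>\<^sup>+y. f (x(m := y)) \<partial>lborel)
          = ennreal \<bar>a\<bar> * (\<integral>\<^sup>+y. f (x(m := g (x(m := 0)) + a * y)) \<partial>lborel)"
        using fm[OF x f] \<open>a \<noteq> 0\<close> by (intro nn_integral_real_affine) auto
      also have "\<dots> = (\<integral>\<^sup>+y. ennreal \<bar>a\<bar> * f (?T (x(m := y))) \<partial>lborel)"
        unfolding Tx[symmetric] using fm[OF x fT] by (simp add: nn_integral_cmult)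
      finally show "(\<integral>\<^sup>+y. ennreal \<bar>a\<bar> * f (?T (x(m := y))) \<partial>lborel) = (\<integral>\<^sup>+y. f (x(m := y)) \<partial>lborel)" ..
    qed
    also have "\<dots> = (\<integral>\<^sup>+v. f v \<partial>leb_d d)"
      unfolding leb using f by (intro product_nn_integral_insert[symmetric] I) (simp add: leb)
    finally show ?thesis ..
  qed
  show ?thesis by (rule leb_scalesI[OF _ T *]) (use \<open>a \<noteq> 0\<close> in simp_all)
qed

section \<open>Triangular matrices and their inverses\<close>

definition linmap :: "nat \<Rightarrow> real mat \<Rightarrow> (nat \<Rightarrow> real) \<Rightarrow> nat \<Rightarrow> real" where
  "linmap d G v = (\<lambda>i\<in>{..<d}. \<Sum>j<d. G $$ (i, j) * v j)"

text \<open>The state of an in-place computation of \<open>linmap\<close> after the rows in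
  \<open>W\<close> have been written; it runs from the identity to the full map.\<close>

definition partial_linmap :: "nat \<Rightarrow> real mat \<Rightarrow> nat set \<Rightarrow> (nat \<Rightarrow> real) \<Rightarrow> nat \<Rightarrow> real" where
  "partial_linmap d G W v = (\<lambda>i\<in>{..<d}. if i \<in> W then \<Sum>j<d. G $$ (i, j) * v j else v i)"

lemma vec_linmap: "G \<in> carrier_mat d d \<Longrightarrow> vec d (linmap d G v) = G *\<^sub>v vec d v"
  by (intro eq_vecI) (auto simp: linmap_def scalar_prod_def atLeast0LessThan)

lemma linmap_mult:
  assumes "G \<in> carrier_mat d d" "H \<in> carrier_mat d d"
  shows "linmap d G (linmap d H v) = linmap d (G * H) v"
proof -
  have "(\<Sum>j<d. G $$ (i, j) * (\<Sum>k<d. H $$ (j, k) * v k)) = (\<Sum>k<d. (G * H) $$ (i, k) * v k)" if "i < d" for i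
  proof -
    have "(\<Sum>j<d. G $$ (i, j) * (\<Sum>k<d. H $$ (j, k) * v k)) = (\<Sum>k<d. \<Sum>j<d. G $$ (i, j) * H $$ (j, k) * v k)"
      by (subst sum.swap) (simp add: sum_distrib_left mult.assoc)
    also have "\<dots> = (\<Sum>k<d. (G * H) $$ (i, k) * v k)"
      using assms that by (intro sum.cong) (auto simp: scalar_prod_def atLeast0LessThan sum_distrib_right)
    finally show ?thesis .
  qed
  then show ?thesis by (auto simp: linmap_def restrict_def)
qed

lemma linmap_one:
  assumes "v \<in> extensional {..<d}"
  shows "linmap d (1\<^sub>m d) v = v"
proof
  fix i
  show "linmap d (1\<^sub>m d) v i = v i"
    using assms by (cases "i < d")
      (auto simp: linmap_def extensional_def if_distrib[of "\<lambda>z. z * _"] cong: if_cong)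
qed

text \<open>Writing row \<open>m\<close> in place still applies it to the original vector, because
  by assumption row \<open>m\<close> vanishes on every coordinate that has been overwritten. The
  extra factor is that of a one-coordinate update.\<close>

lemma leb_scales_partial_linmap_insert:
  assumes T: "leb_scales d (partial_linmap d G W) c"
    and m: "m < d" "m \<notin> W" "G $$ (m, m) \<noteq> 0" and 0: "\<And>j. j < d \<Longrightarrow> j \<in> W \<Longrightarrow> G $$ (m, j) = 0"
  shows "leb_scales d (partial_linmap d G (insert m W)) (c * \<bar>G $$ (m, m)\<bar>)"
proof -
  define g where "g v = (\<Sum>j\<in>{..<d}-{m}. G $$ (m, j) * v j)" for v :: "nat \<Rightarrow> real"
  have "leb_scales d (\<lambda>v. v(m := G $$ (m, m) * v m + g v)) \<bar>G $$ (m, m)\<bar>"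
  proof (rule leb_scales_update)
    show "g \<in> borel_measurable (leb_d d)" unfolding g_def by measurable auto
  qed (use m in \<open>auto simp: g_def\<close>)
  from leb_scales_comp[OF T this] show ?thesis
  proof (rule leb_scales_cong)
    fix v :: "nat \<Rightarrow> real"
    let ?u = "partial_linmap d G W v"
    have g: "g ?u = (\<Sum>j\<in>{..<d}-{m}. G $$ (m, j) * v j)"
      unfolding g_def using 0 by (intro sum.cong) (auto simp: partial_linmap_def)
    show "?u(m := G $$ (m, m) * ?u m + g ?u) = partial_linmap d G (insert m W) v"
    proof
      fix i
      show "(?u(m := G $$ (m, m) * ?u m + g ?u)) i = partial_linmap d G (insert m W) v i"
      proof (cases "i = m")
        case True
        then show ?thesis
          unfolding fun_upd_apply g using m by (simp add: partial_linmap_def sum.remove[of _ m])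
      next
        case False
        then show ?thesis by (simp add: partial_linmap_def)
      qed
    qed
  qed
qed

lemma leb_scales_partial_linmap_empty: "leb_scales d (partial_linmap d G {}) 1"
proof -
  have "leb_scales d (\<lambda>v. v) 1" by (rule leb_scalesI) auto
  then show ?thesis
    by (rule leb_scales_cong) (auto simp: partial_linmap_def extensional_restrict)
qed

lemma partial_linmap_all: "partial_linmap d G {..<d} = linmap d G"
  by (auto simp: fun_eq_iff partial_linmap_def linmap_def restrict_def)

text \<open>Rows are written from the top down: row \<open>n\<close> reads only coordinates from
  \<open>n\<close> on, which are still untouched.\<close>

lemma leb_scales_upper_triangular:
  assumes "\<And>i. i < d \<Longrightarrow> G $$ (i, i) \<noteq> 0" "\<And>i j. i < d \<Longrightarrow> j < i \<Longrightarrow> G $$ (i, j) = 0"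
  shows "leb_scales d (linmap d G) (\<Prod>i<d. \<bar>G $$ (i, i)\<bar>)"
proof -
  have "n \<le> d \<Longrightarrow> leb_scales d (partial_linmap d G {..<n}) (\<Prod>i<n. \<bar>G $$ (i, i)\<bar>)" for n
  proof (induction n)
    case 0
    show ?case using leb_scales_partial_linmap_empty by simp
  next
    case (Suc n)
    then show ?case
      using leb_scales_partial_linmap_insert[of d G "{..<n}" "\<Prod>i<n. \<bar>G $$ (i, i)\<bar>" n] assms
      by (simp add: lessThan_Suc mult.commute)
  qed
  from this[of d] show ?thesis by (simp add: partial_linmap_all atLeast0LessThan)
qed

text \<open>Mirror image of the upper triangular case: rows are written from the bottom up, hence
  the downward induction.\<close>

lemma leb_scales_lower_triangular:
  assumes "\<And>i. i < d \<Longrightarrow> G $$ (i, i) \<noteq> 0" "\<And>i j. j < d \<Longrightarrow> i < j \<Longrightarrow> G $$ (i, j) = 0"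
  shows "leb_scales d (linmap d G) (\<Prod>i<d. \<bar>G $$ (i, i)\<bar>)"
proof -
  have "n \<le> d \<Longrightarrow> leb_scales d (partial_linmap d G {n..<d}) (\<Prod>i\<in>{n..<d}. \<bar>G $$ (i, i)\<bar>)" for n
  proof (induction rule: inc_induct)
    case base
    show ?case using leb_scales_partial_linmap_empty by simp
  next
    case (step n)
    then have "{n..<d} = insert n {Suc n..<d}" by auto
    then show ?case
      using leb_scales_partial_linmap_insert[of d G "{Suc n..<d}" "\<Prod>i\<in>{Suc n..<d}. \<bar>G $$ (i, i)\<bar>" n] assms step
      by (simp add: mult.commute)
  qed
  from this[of 0] show ?thesis by (simp add: partial_linmap_all atLeast0LessThan)
qed

text \<open>The formula for \<open>G\<close>, applied to \<open>f\<close> composed with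
  \<open>H\<close>, has the plain integral of \<open>f\<close> on its right-hand side. This handles
  inverses without examining their shape.\<close>

lemma leb_scales_inverse:
  assumes T: "leb_scales d (linmap d G) c" and GH: "G \<in> carrier_mat d d" "H \<in> carrier_mat d d" "H * G = 1\<^sub>m d"
  shows "leb_scales d (linmap d H) (1 / c)"
proof -
  have c: "c > 0" by (rule leb_scalesD[OF T])
  have m: "linmap d H \<in> measurable (leb_d d) (leb_d d)"
    unfolding leb_d_def linmap_def by measurable
  show ?thesis
  proof (rule leb_scalesI)
    fix f :: "_ \<Rightarrow> ennreal"
    assume f: "f \<in> borel_measurable (leb_d d)"
    have "(\<integral>\<^sup>+v. f (linmap d H v) \<partial>leb_d d) = ennreal c * (\<integral>\<^sup>+v. f (linmap d H (linmap d G v)) \<partial>leb_d d)"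
      by (rule leb_scalesD(3)[OF T measurable_compose[OF m f]])
    also have "(\<integral>\<^sup>+v. f (linmap d H (linmap d G v)) \<partial>leb_d d) = (\<integral>\<^sup>+v. f v \<partial>leb_d d)"
      using GH by (intro nn_integral_cong) (simp add: linmap_mult linmap_one space_leb_d)
    finally show "(\<integral>\<^sup>+v. f v \<partial>leb_d d) = ennreal (1 / c) * (\<integral>\<^sup>+v. f (linmap d H v) \<partial>leb_d d)"
      using c by (simp add: mult.assoc[symmetric] ennreal_mult'[symmetric])
  qed (use c m in auto)
qed

section \<open>Sign changes and quarter turns\<close>

lemma leb_scales_negate:
  assumes "r < d"
  shows "leb_scales d (\<lambda>v. v(r := - v r)) 1"
  using leb_scales_update[of r d "-1" "\<lambda>_. 0"] assms by simp

text \<open>A quarter turn is a product of three shears: subtract \<open>v c\<close> from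
  \<open>v r\<close>, add the result to \<open>v c\<close>, subtract again. The sign in this
  exchange disappears when diagonal entries are conjugated.\<close>

lemma leb_scales_rotate:
  assumes "r < d" "c < d" "r \<noteq> c"
  shows "leb_scales d (\<lambda>v. v(r := - v c, c := v r)) 1"
proof -
  have 1: "leb_scales d (\<lambda>v. v(r := 1 * v r + - v c)) \<bar>1\<bar>"
    using assms by (intro leb_scales_update) auto
  have 2: "leb_scales d (\<lambda>v. v(c := 1 * v c + v r)) \<bar>1\<bar>"
    using assms by (intro leb_scales_update) auto
  from leb_scales_comp[OF leb_scales_comp[OF 1 2] 1] have "leb_scales d (\<lambda>v.
     (v(r := 1 * v r + - v c, c := 1 * (v(r := 1 * v r + - v c)) c + (v(r := 1 * v r + - v c)) r))
       (r := 1 * (v(r := 1 * v r + - v c, c := 1 * (v(r := 1 * v r + - v c)) c + (v(r := 1 * v r + - v c)) r)) r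
          + - (v(r := 1 * v r + - v c, c := 1 * (v(r := 1 * v r + - v c)) c + (v(r := 1 * v r + - v c)) r)) c)) 1"
    by simp
  then show ?thesis
    by (rule leb_scales_cong) (use assms in auto)
qed

section \<open>Gaussian laws\<close>

lemma mat_inv_eqI:
  assumes "S \<in> carrier_mat d d" "T \<in> carrier_mat d d" "S * T = 1\<^sub>m d"
  shows "mat_inv d S = T"
  unfolding mat_inv_def
proof (rule the_equality)
  fix T' assume T': "T' \<in> carrier_mat d d \<and> S * T' = 1\<^sub>m d"
  have "T * S = 1\<^sub>m d" using assms mat_mult_left_right_inverse by blast
  then have "T' = T * S * T'" using T' left_mult_one_mat[of T' d d] by simp
  also have "\<dots> = T * (S * T')" using assms T' by (intro assoc_mult_mat) auto
  finally show "T' = T" using T' assms by simp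
qed (use assms in auto)

lemma mat_inv_one: "mat_inv d (1\<^sub>m d) = 1\<^sub>m d"
  by (rule mat_inv_eqI) auto

lemma gauss_pdf_measurable [measurable]:
  assumes "S \<in> carrier_mat d d" "T \<in> carrier_mat d d" "S * T = 1\<^sub>m d"
  shows "gauss_pdf d S \<in> borel_measurable (leb_d d)"
proof -
  have "vec d v \<bullet> (T *\<^sub>v vec d v) = (\<Sum>i<d. v i * (\<Sum>j<d. T $$ (i, j) * v j))" for v
    using assms(2) by (simp add: scalar_prod_def atLeast0LessThan)
  then have "gauss_pdf d S = (\<lambda>v. exp (- (\<Sum>i<d. v i * (\<Sum>j<d. T $$ (i, j) * v j)) / 2) / sqrt ((2 * pi) ^ d * det S))"
    by (simp add: fun_eq_iff gauss_pdf_def mat_inv_eqI[OF assms])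
  also have "\<dots> \<in> borel_measurable (leb_d d)" by measurable
  finally show ?thesis .
qed

text \<open>Both \<open>G\<close> and \<open>H\<^sup>T\<close> have to change volume by their determinants: when the inputs are
  transformed by \<open>G\<close>, the weight vector is transformed by the inverse transpose \<open>H\<^sup>T\<close>.\<close>

definition volume_pair :: "nat \<Rightarrow> real mat \<Rightarrow> real mat \<Rightarrow> bool" where
  "volume_pair d G H \<longleftrightarrow> G \<in> carrier_mat d d \<and> H \<in> carrier_mat d d \<and> G * H = 1\<^sub>m d \<and> H * G = 1\<^sub>m d \<and>
     leb_scales d (linmap d G) \<bar>det G\<bar> \<and> leb_scales d (linmap d H\<^sup>T) \<bar>det H\<^sup>T\<bar>"

text \<open>Exchanges the roles of inputs and weights: facts about \<open>G\<close> and the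
  covariance \<open>G * G\<^sup>T\<close> carry over to \<open>H\<^sup>T\<close> and the inverse
  covariance \<open>H\<^sup>T * H\<close>.\<close>

lemma volume_pair_transpose:
  assumes "volume_pair d G H"
  shows "volume_pair d H\<^sup>T G\<^sup>T"
proof -
  have "H\<^sup>T * G\<^sup>T = (G * H)\<^sup>T" "G\<^sup>T * H\<^sup>T = (H * G)\<^sup>T"
    using assms transpose_mult unfolding volume_pair_def by metis+
  then show ?thesis using assms by (auto simp: volume_pair_def)
qed

lemma mult_transpose_inverse:
  assumes "volume_pair d G H"
  shows "G * G\<^sup>T * (H\<^sup>T * H) = 1\<^sub>m d"
proof -
  note vp = assms[unfolded volume_pair_def]
  have c: "G \<in> carrier_mat d d" "H \<in> carrier_mat d d" "G\<^sup>T \<in> carrier_mat d d" "H\<^sup>T \<in> carrier_mat d d"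
    using vp by auto
  have "G\<^sup>T * H\<^sup>T = 1\<^sub>m d" using volume_pair_transpose[OF assms] by (simp add: volume_pair_def)
  then have "G * G\<^sup>T * H\<^sup>T = G" using c by (simp add: assoc_mult_mat[of _ d d _ d _ d])
  moreover have "G * G\<^sup>T * (H\<^sup>T * H) = G * G\<^sup>T * H\<^sup>T * H"
    using c by (intro assoc_mult_mat[symmetric]) auto
  ultimately show ?thesis using vp by simp
qed

lemma mat_inv_mult_transpose:
  assumes "volume_pair d G H"
  shows "mat_inv d (G * G\<^sup>T) = H\<^sup>T * H"
  using assms mult_transpose_inverse[OF assms] by (intro mat_inv_eqI) (auto simp: volume_pair_def)

text \<open>At \<open>G v\<close> the quadratic form of the inverse covariance is the squared norm
  of \<open>v\<close>, and the root of the determinant of \<open>G * G\<^sup>T\<close> is the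
  Jacobian factor that cancels.\<close>

lemma gauss_pdf_linmap:
  assumes vp: "volume_pair d G H"
  shows "\<bar>det G\<bar> * gauss_pdf d (G * G\<^sup>T) (linmap d G v) = gauss_pdf d (1\<^sub>m d) v"
proof -
  have c: "G \<in> carrier_mat d d" "H \<in> carrier_mat d d" and inv: "G * H = 1\<^sub>m d" "H * G = 1\<^sub>m d"
    and det: "\<bar>det G\<bar> > 0"
    using vp leb_scalesD(1) unfolding volume_pair_def by blast+
  let ?v = "vec d v"
  have Hv: "H *\<^sub>v (G *\<^sub>v ?v) = ?v"
    using c inv by (simp add: assoc_mult_mat_vec[symmetric, of _ d d _ d])
  have "(G *\<^sub>v ?v) \<bullet> (H\<^sup>T * H *\<^sub>v (G *\<^sub>v ?v)) = (G *\<^sub>v ?v) \<bullet> (H\<^sup>T *\<^sub>v ?v)"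
    using c Hv by (simp add: assoc_mult_mat_vec[of "H\<^sup>T" d d H d])
  also have "\<dots> = (H\<^sup>T *\<^sub>v ?v) \<bullet> (G *\<^sub>v ?v)"
    using c by (intro comm_scalar_prod[of _ d]) auto
  also have "\<dots> = ?v \<bullet> (H *\<^sub>v (G *\<^sub>v ?v))"
    using c by (intro transpose_vec_mult_scalar) auto
  finally have q: "(G *\<^sub>v ?v) \<bullet> (H\<^sup>T * H *\<^sub>v (G *\<^sub>v ?v)) = ?v \<bullet> ?v" using Hv by simp
  have "det (G * G\<^sup>T) = \<bar>det G\<bar>\<^sup>2"
    using c by (simp add: det_mult[of _ d] det_transpose power2_eq_square)
  then have s: "sqrt ((2 * pi) ^ d * det (G * G\<^sup>T)) = sqrt ((2 * pi) ^ d) * \<bar>det G\<bar>"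
    by (simp add: real_sqrt_mult)
  have "gauss_pdf d (G * G\<^sup>T) (linmap d G v) = exp (- (?v \<bullet> ?v) / 2) / (sqrt ((2 * pi) ^ d) * \<bar>det G\<bar>)"
    unfolding gauss_pdf_def vec_linmap[OF c(1)] mat_inv_mult_transpose[OF vp] q s ..
  moreover have "gauss_pdf d (1\<^sub>m d) v = exp (- (?v \<bullet> ?v) / 2) / sqrt ((2 * pi) ^ d)"
    by (simp add: gauss_pdf_def mat_inv_one)
  ultimately show ?thesis using det by simp
qed

lemma sets_mvnormal [simp, measurable_cong]: "sets (mvnormal d C) = sets (leb_d d)"
  by (simp add: mvnormal_def)

lemma mvnormal_linmap:
  assumes vp: "volume_pair d G H"
  shows "mvnormal d (G * G\<^sup>T) = distr (mvnormal d (1\<^sub>m d)) (leb_d d) (linmap d G)"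
proof (rule measure_eqI)
  fix A assume "A \<in> sets (mvnormal d (G * G\<^sup>T))"
  then have A [measurable]: "A \<in> sets (leb_d d)" by simp
  have sc: "leb_scales d (linmap d G) \<bar>det G\<bar>" using vp by (simp add: volume_pair_def)
  then have G [measurable]: "linmap d G \<in> measurable (leb_d d) (leb_d d)" by (rule leb_scalesD)
  have [measurable]: "gauss_pdf d (1\<^sub>m d) \<in> borel_measurable (leb_d d)"
    by (rule gauss_pdf_measurable[of _ _ "1\<^sub>m d"]) auto
  have [measurable]: "gauss_pdf d (G * G\<^sup>T) \<in> borel_measurable (leb_d d)"
    using vp mult_transpose_inverse[OF vp]
    by (intro gauss_pdf_measurable[of _ _ "H\<^sup>T * H"]) (auto simp: volume_pair_def)
  have "emeasure (mvnormal d (G * G\<^sup>T)) A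
      = (\<integral>\<^sup>+v. ennreal (gauss_pdf d (G * G\<^sup>T) v) * indicator A v \<partial>leb_d d)"
    unfolding mvnormal_def by (intro emeasure_density) auto
  also have "\<dots> = ennreal \<bar>det G\<bar> *
      (\<integral>\<^sup>+v. ennreal (gauss_pdf d (G * G\<^sup>T) (linmap d G v)) * indicator A (linmap d G v) \<partial>leb_d d)"
    by (rule leb_scalesD(3)[OF sc]) measurable
  also have "\<dots> = (\<integral>\<^sup>+v. ennreal \<bar>det G\<bar> *
      (ennreal (gauss_pdf d (G * G\<^sup>T) (linmap d G v)) * indicator A (linmap d G v)) \<partial>leb_d d)"
    by (rule nn_integral_cmult[symmetric]) measurable
  also have "\<dots> = (\<integral>\<^sup>+v. ennreal (gauss_pdf d (1\<^sub>m d) v) *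
      indicator (linmap d G -` A \<inter> space (leb_d d)) v \<partial>leb_d d)"
    by (intro nn_integral_cong)
       (simp add: mult.assoc[symmetric] ennreal_mult'[symmetric] gauss_pdf_linmap[OF vp] indicator_def)
  also have "\<dots> = emeasure (mvnormal d (1\<^sub>m d)) (linmap d G -` A \<inter> space (leb_d d))"
    unfolding mvnormal_def by (intro emeasure_density[symmetric]) measurable
  also have "\<dots> = emeasure (distr (mvnormal d (1\<^sub>m d)) (leb_d d) (linmap d G)) A"
    by (subst emeasure_distr) (auto simp: mvnormal_def)
  finally show "emeasure (mvnormal d (G * G\<^sup>T)) A
      = emeasure (distr (mvnormal d (1\<^sub>m d)) (leb_d d) (linmap d G)) A" .
qed simp

text \<open>For identity covariance the density factors over the coordinates, so it suffices to
  compare the measures on boxes. The product form yields total mass one and all moments from the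
  one-dimensional normal law.\<close>

lemma mvnormal_one:
  "mvnormal d (1\<^sub>m d) = PiM {..<d} (\<lambda>_. density lborel std_normal_density)"
proof -
  interpret N: product_sigma_finite "\<lambda>_::nat. density lborel std_normal_density"
    by (simp add: product_sigma_finite_def prob_space_normal_density prob_space_imp_sigma_finite)
  interpret L: product_sigma_finite "\<lambda>_::nat. lborel :: real measure" ..
  have pdf: "gauss_pdf d (1\<^sub>m d) v = (\<Prod>i<d. std_normal_density (v i))" for v
  proof -
    have "vec d v \<bullet> vec d v = (\<Sum>i<d. (v i)\<^sup>2)"
      by (simp add: scalar_prod_def atLeast0LessThan power2_eq_square)
    then have "gauss_pdf d (1\<^sub>m d) v = exp (\<Sum>i<d. - (v i)\<^sup>2 / 2) / sqrt (2 * pi) ^ d"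
      by (simp add: gauss_pdf_def mat_inv_one sum_divide_distrib[symmetric] sum_negf flip: real_sqrt_power)
    also have "\<dots> = (\<Prod>i<d. std_normal_density (v i))"
      by (simp add: exp_sum std_normal_density_def prod.distrib power_one_over prod_dividef)
    finally show ?thesis .
  qed
  have [measurable]: "gauss_pdf d (1\<^sub>m d) \<in> borel_measurable (leb_d d)"
    by (rule gauss_pdf_measurable[of _ _ "1\<^sub>m d"]) auto
  show ?thesis
  proof (rule N.PiM_eqI)
    show "sets (mvnormal d (1\<^sub>m d)) = sets (PiM {..<d} (\<lambda>_. density lborel std_normal_density))"
      unfolding sets_mvnormal leb_d_def by (rule sets_PiM_cong) auto
    fix A assume "\<And>i. i \<in> {..<d} \<Longrightarrow> A i \<in> sets (density lborel std_normal_density)"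
    then have A [measurable]: "\<And>i. i < d \<Longrightarrow> A i \<in> sets borel" by simp
    have [measurable]: "PiE {..<d} A \<in> sets (leb_d d)"
      unfolding leb_d_def using A by (intro sets_PiM_I_finite) auto
    have "emeasure (mvnormal d (1\<^sub>m d)) (PiE {..<d} A)
        = (\<integral>\<^sup>+v. ennreal (gauss_pdf d (1\<^sub>m d) v) * indicator (PiE {..<d} A) v \<partial>leb_d d)"
      unfolding mvnormal_def by (intro emeasure_density) measurable
    also have "\<dots> = (\<integral>\<^sup>+v. (\<Prod>i<d. ennreal (std_normal_density (v i)) * indicator (A i) (v i)) \<partial>leb_d d)"
    proof (rule nn_integral_cong)
      fix v assume "v \<in> space (leb_d d)"
      then have "v \<in> PiE {..<d} A \<longleftrightarrow> (\<forall>i<d. v i \<in> A i)" by (auto simp: space_leb_d PiE_def)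
      then have "indicator (PiE {..<d} A) v = (\<Prod>i<d. indicator (A i) (v i) :: ennreal)"
        by (auto simp: indicator_def prod_zero_iff)
      then show "ennreal (gauss_pdf d (1\<^sub>m d) v) * indicator (PiE {..<d} A) v
          = (\<Prod>i<d. ennreal (std_normal_density (v i)) * indicator (A i) (v i))"
        by (simp add: pdf prod.distrib prod_ennreal)
    qed
    also have "\<dots> = (\<Prod>i<d. \<integral>\<^sup>+x. ennreal (std_normal_density x) * indicator (A i) x \<partial>lborel)"
      unfolding leb_d_def using A by (intro L.product_nn_integral_prod) auto
    also have "\<dots> = (\<Prod>i<d. emeasure (density lborel std_normal_density) (A i))"
      by (intro prod.cong refl emeasure_density[symmetric]) auto
    finally show "emeasure (mvnormal d (1\<^sub>m d)) (PiE {..<d} A)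
        = (\<Prod>i<d. emeasure (density lborel std_normal_density) (A i))" .
  qed simp
qed

lemma prob_space_mvnormal_one: "prob_space (mvnormal d (1\<^sub>m d))"
  unfolding mvnormal_one by (intro prob_space_PiM prob_space_normal_density) simp

text \<open>The weight covariance is the inverse of \<open>G * G\<^sup>T\<close>, that is
  \<open>H\<^sup>T * H\<close>, so it is produced by \<open>H\<^sup>T\<close>. Using
  \<open>compose\<close> keeps the family of inputs undefined outside its index range, as the
  product space demands.\<close>

lemma icl_law_linmap:
  assumes vp: "volume_pair d G H"
  shows "icl_law d n (G * G\<^sup>T) = distr (icl_law d n (1\<^sub>m d)) (icl_law d n (1\<^sub>m d))
           (\<lambda>(xs, w). (compose {1..n+1} (linmap d G) xs, linmap d H\<^sup>T w))"
proof -
  let ?N = "mvnormal d (1\<^sub>m d)"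
  interpret N: prob_space ?N by (rule prob_space_mvnormal_one)
  have vp': "volume_pair d H\<^sup>T G\<^sup>T" by (rule volume_pair_transpose[OF vp])
  have G [measurable]: "linmap d G \<in> measurable ?N ?N" and H [measurable]: "linmap d H\<^sup>T \<in> measurable ?N ?N"
    using leb_scalesD(2) vp unfolding volume_pair_def by (auto cong: measurable_cong_sets)
  have dG: "mvnormal d (G * G\<^sup>T) = distr ?N ?N (linmap d G)"
    unfolding mvnormal_linmap[OF vp] by (rule distr_cong) auto
  have dH: "mvnormal d (H\<^sup>T * H) = distr ?N ?N (linmap d H\<^sup>T)"
    using mvnormal_linmap[OF vp'] by (simp cong: distr_cong)
  have P: "PiM {1..n+1} (\<lambda>_. distr ?N ?N (linmap d G))
      = distr (PiM {1..n+1} (\<lambda>_. ?N)) (PiM {1..n+1} (\<lambda>_. ?N)) (compose {1..n+1} (linmap d G))"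
    by (rule distr_PiM_finite_prob_space'[symmetric]) (auto intro: prob_space_mvnormal_one)
  show ?thesis
    unfolding icl_law_def mat_inv_mult_transpose[OF vp] mat_inv_one dG dH P
  proof (rule pair_measure_distr)
    show "compose {1..n+1} (linmap d G) \<in> measurable (PiM {1..n+1} (\<lambda>_. ?N)) (PiM {1..n+1} (\<lambda>_. ?N))"
      unfolding compose_def by measurable
    show "sigma_finite_measure (distr ?N ?N (linmap d H\<^sup>T))"
      by (intro prob_space_imp_sigma_finite N.prob_space_distr) measurable
  qed measurable
qed

section \<open>Equivariance of the layers\<close>

lemma mult_mat_entry:
  assumes "A \<in> carrier_mat nr m" "B \<in> carrier_mat m nc" "r < nr" "c < nc"
  shows "(A * B) $$ (r, c) = (\<Sum>s<m. A $$ (r, s) * B $$ (s, c))"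
  using assms by (simp add: scalar_prod_def atLeast0LessThan)

lemma Pmat_carrier [simp]: "B \<in> carrier_mat d d \<Longrightarrow> Pmat d B \<in> carrier_mat (Suc d) (Suc d)"
  using four_block_carrier_mat[of B d d "1\<^sub>m 1" 1 1] by (simp add: Pmat_def)

lemma Qmat_carrier [simp]: "A \<in> carrier_mat d d \<Longrightarrow> Qmat d A \<in> carrier_mat (Suc d) (Suc d)"
  using four_block_carrier_mat[of A d d "0\<^sub>m 1 1" 1 1] by (simp add: Qmat_def)

lemma Mmask_carrier [simp]: "Mmask n \<in> carrier_mat (Suc n) (Suc n)"
  using four_block_carrier_mat[of "1\<^sub>m n" n n "0\<^sub>m 1 1" 1 1] by (simp add: Mmask_def)

lemma Z0_carrier [simp]: "Z0 d n xs w \<in> carrier_mat (Suc d) (Suc n)"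
  by (simp add: Z0_def)

lemma Pmat_mult:
  assumes "A \<in> carrier_mat d d" "B \<in> carrier_mat d d"
  shows "Pmat d A * Pmat d B = Pmat d (A * B)"
  unfolding Pmat_def using assms
  by (subst mult_four_block_mat[of _ d d _ 1 _ 1]) auto

lemma Pmat_one: "Pmat d (1\<^sub>m d) = 1\<^sub>m (Suc d)"
  by (rule eq_matI) (auto simp: Pmat_def)

lemma Pmat_transpose: "B \<in> carrier_mat d d \<Longrightarrow> (Pmat d B)\<^sup>T = Pmat d B\<^sup>T"
  unfolding Pmat_def by (subst transpose_four_block_mat[of _ d d _ 1 _ 1]) auto

lemma Pmat_Qmat_Pmat:
  assumes "A \<in> carrier_mat d d" "B \<in> carrier_mat d d" "C \<in> carrier_mat d d"
  shows "Pmat d A * Qmat d B * Pmat d C = Qmat d (A * B * C)"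
  unfolding Pmat_def Qmat_def using assms
  by (subst mult_four_block_mat[of _ d d _ 1 _ 1], auto)
     (subst mult_four_block_mat[of _ d d _ 1 _ 1], auto)

lemma Zseq_carrier:
  assumes "\<And>i. i < m \<Longrightarrow> A i \<in> carrier_mat d d" "\<And>i. i < m \<Longrightarrow> B i \<in> carrier_mat d d"
  shows "Zseq d n A B xs w m \<in> carrier_mat (Suc d) (Suc n)"
  using assms
proof (induction m)
  case (Suc m)
  then have "Zseq d n A B xs w m \<in> carrier_mat (Suc d) (Suc n)" "Pmat d (B m) \<in> carrier_mat (Suc d) (Suc d)"
    "Qmat d (A m) \<in> carrier_mat (Suc d) (Suc d)" by auto
  then show ?case by (auto simp: Let_def intro!: mult_carrier_mat[of _ _ "Suc n"] mult_carrier_mat[of _ _ "Suc d"])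
qed simp

lemma Zseq_cong:
  assumes "\<And>i. i < m \<Longrightarrow> A i = A' i" "\<And>i. i < m \<Longrightarrow> B i = B' i"
  shows "Zseq d n A B xs w m = Zseq d n A' B' xs w m"
  using assms by (induction m) (auto simp: Let_def)

text \<open>The reason for moving the weights by the inverse transpose: the labels and the target
  are inner products of an input with the weights, and these do not change.\<close>

lemma linmap_dual:
  assumes "G \<in> carrier_mat d d" "H \<in> carrier_mat d d" "H * G = 1\<^sub>m d"
  shows "vec d (linmap d G v) \<bullet> vec d (linmap d H\<^sup>T w) = vec d v \<bullet> vec d w"
proof -
  have "(G *\<^sub>v vec d v) \<bullet> (H\<^sup>T *\<^sub>v vec d w) = (H\<^sup>T *\<^sub>v vec d w) \<bullet> (G *\<^sub>v vec d v)"
    using assms by (intro comm_scalar_prod[of _ d]) auto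
  also have "\<dots> = vec d w \<bullet> (H *\<^sub>v (G *\<^sub>v vec d v))"
    using assms by (intro transpose_vec_mult_scalar) auto
  also have "H *\<^sub>v (G *\<^sub>v vec d v) = vec d v"
    using assms by (simp add: assoc_mult_mat_vec[symmetric, of _ d d _ d])
  also have "vec d w \<bullet> vec d v = vec d v \<bullet> vec d w"
    by (intro comm_scalar_prod[of _ d]) auto
  finally show ?thesis using assms by (simp add: vec_linmap)
qed

lemma Z0_linmap:
  assumes G: "G \<in> carrier_mat d d" and H: "H \<in> carrier_mat d d" and HG: "H * G = 1\<^sub>m d"
  shows "Z0 d n (compose {1..Suc n} (linmap d G) xs) (linmap d H\<^sup>T w) = Pmat d G * Z0 d n xs w"
proof (rule eq_matI)
  fix r c assume "r < dim_row (Pmat d G * Z0 d n xs w)" "c < dim_col (Pmat d G * Z0 d n xs w)"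
  then have r: "r < Suc d" and c: "c < Suc n" using G by (auto simp: Z0_def Pmat_def)
  have "(Pmat d G * Z0 d n xs w) $$ (r, c) = (\<Sum>s<Suc d. Pmat d G $$ (r, s) * Z0 d n xs w $$ (s, c))"
    by (rule mult_mat_entry[OF Pmat_carrier[OF G] Z0_carrier r c])
  also have "\<dots> = (if r < d then \<Sum>s<d. G $$ (r, s) * xs (c+1) s else Z0 d n xs w $$ (d, c))"
    using r c G by (auto simp: Pmat_def Z0_def)
  also have "\<dots> = Z0 d n (compose {1..Suc n} (linmap d G) xs) (linmap d H\<^sup>T w) $$ (r, c)"
  proof (cases "r < d")
    case True
    then show ?thesis using c by (simp add: Z0_def compose_def linmap_def)
  next
    case False
    have "vec d (linmap d G v) \<bullet> vec d (linmap d H\<^sup>T w) = vec d v \<bullet> vec d w" for v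
      by (rule linmap_dual[OF G H HG])
    then show ?thesis using False r c by (auto simp: Z0_def compose_def)
  qed
  finally show "Z0 d n (compose {1..Suc n} (linmap d G) xs) (linmap d H\<^sup>T w) $$ (r, c)
      = (Pmat d G * Z0 d n xs w) $$ (r, c)" ..
qed (use G in \<open>auto simp: Z0_def Pmat_def\<close>)

text \<open>The invariant is that the transformed state is \<open>Pmat d G\<close> times the
  original one. \<open>Pmat d H\<close> undoes this factor inside both products of a layer: the
  scores formed with \<open>Qmat\<close> are unchanged, and the product with \<open>Pmat\<close>
  keeps a single factor \<open>Pmat d G\<close> on the left, which can be pulled out of the whole
  update.\<close>

lemma Zseq_linmap:
  assumes G: "G \<in> carrier_mat d d" and H: "H \<in> carrier_mat d d" and HG: "H * G = 1\<^sub>m d"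
    and "\<And>i. i < m \<Longrightarrow> A i \<in> carrier_mat d d" "\<And>i. i < m \<Longrightarrow> B i \<in> carrier_mat d d"
  shows "Zseq d n (\<lambda>i. H\<^sup>T * A i * H) (\<lambda>i. G * B i * H)
           (compose {1..Suc n} (linmap d G) xs) (linmap d H\<^sup>T w) m = Pmat d G * Zseq d n A B xs w m"
  using assms(4,5)
proof (induction m)
  case 0
  show ?case using Z0_linmap[OF G H HG] by simp
next
  case (Suc m)
  define Z where "Z = Zseq d n A B xs w m"
  define P R Pb Qa M where "P = Pmat d G" "R = Pmat d H" "Pb = Pmat d (B m)" "Qa = Qmat d (A m)" "M = Mmask n"
  note defs = this
  define W where "W = Z\<^sup>T * Qa * Z"
  have AB: "A m \<in> carrier_mat d d" "B m \<in> carrier_mat d d" using Suc.prems by auto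
  have c: "Z \<in> carrier_mat (Suc d) (Suc n)" "P \<in> carrier_mat (Suc d) (Suc d)" "R \<in> carrier_mat (Suc d) (Suc d)"
    "Pb \<in> carrier_mat (Suc d) (Suc d)" "Qa \<in> carrier_mat (Suc d) (Suc d)" "M \<in> carrier_mat (Suc n) (Suc n)"
    using Suc.prems G H AB by (auto simp: defs Z_def intro!: Zseq_carrier)
  have W: "W \<in> carrier_mat (Suc n) (Suc n)" using c by (simp add: W_def)
  have RP: "R * P = 1\<^sub>m (Suc d)" using G H HG by (simp add: defs Pmat_mult Pmat_one)
  have RPZ: "R * (P * Z) = Z"
    using c RP by (simp add: assoc_mult_mat[of R "Suc d" "Suc d" P "Suc d" Z "Suc n", symmetric])
  have "Pmat d (G * B m * H) = P * Pb * R" using G H AB by (simp add: defs Pmat_mult)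
  then have a: "Pmat d (G * B m * H) * (P * Z) = P * (Pb * Z)"
    using c RPZ by (simp add: assoc_mult_mat[of _ "Suc d" "Suc d" _ "Suc d" _ "Suc n"]
        assoc_mult_mat[of "P * Pb" "Suc d" "Suc d" R "Suc d" "P * Z" "Suc n"])
  have "Qmat d (H\<^sup>T * A m * H) = R\<^sup>T * Qa * R"
    using H AB by (simp add: defs Pmat_transpose Pmat_Qmat_Pmat)
  then have "(P * Z)\<^sup>T * Qmat d (H\<^sup>T * A m * H) * (P * Z) = (P * Z)\<^sup>T * (R\<^sup>T * Qa * R) * (P * Z)" by simp
  also have "\<dots> = ((P * Z)\<^sup>T * R\<^sup>T) * Qa * (R * (P * Z))"
    using c by (simp add: assoc_mult_mat[of _ "Suc d" "Suc d" _ "Suc d" _ "Suc d"]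
        assoc_mult_mat[of _ "Suc d" "Suc d" _ "Suc d" _ "Suc n"]
        assoc_mult_mat[of _ "Suc n" "Suc d" _ "Suc d" _ "Suc d"]
        assoc_mult_mat[of _ "Suc n" "Suc d" _ "Suc d" _ "Suc n"])
  also have "(P * Z)\<^sup>T * R\<^sup>T = (R * (P * Z))\<^sup>T"
    using c by (intro transpose_mult[symmetric]) auto
  finally have b: "(P * Z)\<^sup>T * Qmat d (H\<^sup>T * A m * H) * (P * Z) = W" by (simp add: RPZ W_def)
  have "Zseq d n (\<lambda>i. H\<^sup>T * A i * H) (\<lambda>i. G * B i * H)
           (compose {1..Suc n} (linmap d G) xs) (linmap d H\<^sup>T w) (Suc m)
      = P * Z + (1 / real n) \<cdot>\<^sub>m (P * (Pb * Z) * M * W)"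
    using Suc by (simp add: Let_def Z_def[symmetric] a b flip: defs(1,5))
  also have "P * (Pb * Z) * M * W = P * (Pb * Z * M * W)"
    using c W by (simp add: assoc_mult_mat[of _ "Suc d" "Suc d" _ "Suc n" _ "Suc n"])
  also have "P * Z + (1 / real n) \<cdot>\<^sub>m (P * (Pb * Z * M * W)) = P * (Z + (1 / real n) \<cdot>\<^sub>m (Pb * Z * M * W))"
  proof -
    have "Pb * Z * M * W \<in> carrier_mat (Suc d) (Suc n)" using c W by auto
    then show ?thesis
      using mult_add_distrib_mat[OF c(2,1), of "(1 / real n) \<cdot>\<^sub>m (Pb * Z * M * W)"]
        mult_smult_distrib[OF c(2), of "Pb * Z * M * W" "Suc n" "1 / real n"] by simp
  qed
  also have "\<dots> = Pmat d G * Zseq d n A B xs w (Suc m)"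
    by (simp add: Let_def W_def Z_def defs)
  finally show ?case .
qed

section \<open>Polynomial dependence on the parameters\<close>

type_synonym sample = "(nat \<Rightarrow> nat \<Rightarrow> real) \<times> (nat \<Rightarrow> real)"

section \<open>Moments and polynomials in the data\<close>

definition data_monomial :: "nat \<Rightarrow> nat \<Rightarrow> (nat \<Rightarrow> nat \<Rightarrow> nat) \<Rightarrow> (nat \<Rightarrow> nat) \<Rightarrow> sample \<Rightarrow> real" where
  "data_monomial d n e e' \<omega> =
     (\<Prod>j\<in>{1..n+1}. \<Prod>i<d. fst \<omega> j i ^ e j i) * (\<Prod>i<d. snd \<omega> i ^ e' i)"

lemma integrable_mvnormal_one_monomial: "integrable (mvnormal d (1\<^sub>m d)) (\<lambda>v. \<Prod>i<d. v i ^ e i)"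
proof -
  interpret N: product_sigma_finite "\<lambda>_::nat. density lborel std_normal_density"
    by (simp add: product_sigma_finite_def prob_space_normal_density prob_space_imp_sigma_finite)
  show ?thesis
    unfolding mvnormal_one
    by (intro N.product_integrable_prod integrable_std_normal_distribution_moment) auto
qed

lemma integrable_pair_mult:
  fixes f :: "'a \<Rightarrow> real" and g :: "'b \<Rightarrow> real"
  assumes "sigma_finite_measure M" "sigma_finite_measure N" "integrable M f" "integrable N g"
  shows "integrable (M \<Otimes>\<^sub>M N) (\<lambda>\<omega>. f (fst \<omega>) * g (snd \<omega>))"
proof -
  interpret pair_sigma_finite M N using assms(1,2) by (simp add: pair_sigma_finite_def)
  have [measurable]: "f \<in> borel_measurable M" "g \<in> borel_measurable N" using assms by auto
  show ?thesis using assms(3,4) by (intro Fubini_integrable) (auto simp: abs_mult)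
qed

lemma integrable_data_monomial: "integrable (icl_law d n (1\<^sub>m d)) (data_monomial d n e e')"
proof -
  let ?N = "mvnormal d (1\<^sub>m d)"
  interpret N: prob_space ?N by (rule prob_space_mvnormal_one)
  interpret PN: product_sigma_finite "\<lambda>_::nat. ?N"
    by (simp add: product_sigma_finite_def N.sigma_finite_measure_axioms)
  let ?P = "PiM {1..n+1} (\<lambda>_. ?N)"
  interpret P: prob_space ?P by (intro prob_space_PiM prob_space_mvnormal_one)
  have 1: "integrable ?P (\<lambda>xs. \<Prod>j\<in>{1..n+1}. \<Prod>i<d. xs j i ^ e j i)"
    by (intro PN.product_integrable_prod integrable_mvnormal_one_monomial) auto
  have 2: "integrable ?N (\<lambda>v. \<Prod>i<d. v i ^ e' i)" by (rule integrable_mvnormal_one_monomial)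
  have "integrable (?P \<Otimes>\<^sub>M ?N) (\<lambda>\<omega>. (\<Prod>j\<in>{1..n+1}. \<Prod>i<d. fst \<omega> j i ^ e j i) * (\<Prod>i<d. snd \<omega> i ^ e' i))"
    by (rule integrable_pair_mult[OF P.sigma_finite_measure_axioms N.sigma_finite_measure_axioms 1 2])
  then show ?thesis unfolding icl_law_def mat_inv_one data_monomial_def .
qed

lemma data_monomial_mult:
  "data_monomial d n e e' \<omega> * data_monomial d n f f' \<omega>
     = data_monomial d n (\<lambda>j i. e j i + f j i) (\<lambda>i. e' i + f' i) \<omega>"
  by (simp add: data_monomial_def power_add prod.distrib mult_ac)

text \<open>Parameters and data are separated: every term is a polynomial in the parameters times a
  monomial in the sample. Taking expectations then only replaces monomials by their moments.\<close>

inductive param_poly :: "'v set \<Rightarrow> nat \<Rightarrow> nat \<Rightarrow> (('v \<Rightarrow> real) \<Rightarrow> sample \<Rightarrow> real) \<Rightarrow> bool" for V d n where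
  monomial: "poly_fun V c \<Longrightarrow> param_poly V d n (\<lambda>\<theta> \<omega>. c \<theta> * data_monomial d n e e' \<omega>)"
| add: "param_poly V d n p \<Longrightarrow> param_poly V d n q \<Longrightarrow> param_poly V d n (\<lambda>\<theta> \<omega>. p \<theta> \<omega> + q \<theta> \<omega>)"

lemma param_poly_coeff:
  assumes "poly_fun V c"
  shows "param_poly V d n (\<lambda>\<theta> \<omega>. c \<theta>)"
  using param_poly.monomial[OF assms, of d n "\<lambda>_ _. 0" "\<lambda>_. 0"] by (simp add: data_monomial_def)

lemma param_poly_fst:
  assumes "j \<in> {1..n+1}" "i < d"
  shows "param_poly V d n (\<lambda>\<theta> \<omega>. fst \<omega> j i)"
proof -
  define e :: "nat \<Rightarrow> nat \<Rightarrow> nat" where "e a b = (if a = j then if b = i then 1 else 0 else 0)" for a b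
  have "(\<Prod>b<d. x b ^ e a b) = (if a = j then x i else 1)" for a and x :: "nat \<Rightarrow> real"
    using assms by (simp add: e_def if_distrib[of "\<lambda>m. _ ^ m"] cong: if_cong)
  then have "data_monomial d n e (\<lambda>_. 0) \<omega> = fst \<omega> j i" for \<omega>
    using assms by (simp add: data_monomial_def)
  then show ?thesis
    using param_poly.monomial[OF poly_fun.const[of V 1], of d n e "\<lambda>_. 0"] by simp
qed

lemma param_poly_snd:
  assumes "i < d"
  shows "param_poly V d n (\<lambda>\<theta> \<omega>. snd \<omega> i)"
proof -
  define e :: "nat \<Rightarrow> nat" where "e b = (if b = i then 1 else 0)" for b
  have "data_monomial d n (\<lambda>_ _. 0) e \<omega> = snd \<omega> i" for \<omega>
    using assms by (simp add: data_monomial_def e_def if_distrib[of "\<lambda>m. _ ^ m"] cong: if_cong)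
  then show ?thesis
    using param_poly.monomial[OF poly_fun.const[of V 1], of d n "\<lambda>_ _. 0" e] by simp
qed

lemma param_poly_monomial_mult:
  assumes "param_poly V d n q" "poly_fun V c"
  shows "param_poly V d n (\<lambda>\<theta> \<omega>. (c \<theta> * data_monomial d n e e' \<omega>) * q \<theta> \<omega>)"
  using assms(1)
proof induction
  case (monomial b f f')
  have *: "(c \<theta> * data_monomial d n e e' \<omega>) * (b \<theta> * data_monomial d n f f' \<omega>)
      = (c \<theta> * b \<theta>) * data_monomial d n (\<lambda>j i. e j i + f j i) (\<lambda>i. e' i + f' i) \<omega>" for \<theta> \<omega>
    by (simp add: data_monomial_mult[symmetric])
  show ?case
    unfolding * by (rule param_poly.monomial[OF poly_fun.mult[OF assms(2) monomial(1)]])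
next
  case (add p q)
  then show ?case using param_poly.add by (simp add: distrib_left)
qed

lemma param_poly_mult:
  assumes "param_poly V d n p" "param_poly V d n q"
  shows "param_poly V d n (\<lambda>\<theta> \<omega>. p \<theta> \<omega> * q \<theta> \<omega>)"
  using assms(1)
proof induction
  case (monomial c e e')
  then show ?case using param_poly_monomial_mult[OF assms(2)] by blast
next
  case (add p q)
  then show ?case using param_poly.add by (simp add: distrib_right)
qed

lemma param_poly_sum:
  assumes "finite S" "\<And>s. s \<in> S \<Longrightarrow> param_poly V d n (p s)"
  shows "param_poly V d n (\<lambda>\<theta> \<omega>. \<Sum>s\<in>S. p s \<theta> \<omega>)"
  using assms
proof (induction S)
  case empty
  show ?case using param_poly_coeff[OF poly_fun.const] by simp
next
  case (insert s S)
  then show ?case using param_poly.add[of V d n "p s"] by simp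
qed

text \<open>Integrability is part of the induction because the integral of a sum splits only when
  both summands are integrable.\<close>

lemma param_poly_expectation:
  assumes "param_poly V d n p"
  shows "(\<forall>\<theta>. integrable (icl_law d n (1\<^sub>m d)) (p \<theta>)) \<and>
         poly_fun V (\<lambda>\<theta>. \<integral>\<omega>. p \<theta> \<omega> \<partial>icl_law d n (1\<^sub>m d))"
  using assms
proof induction
  case (monomial c e e')
  then show ?case
    by (auto intro: integrable_mult_right integrable_data_monomial poly_fun.intros)
next
  case (add p q)
  then show ?case by (auto intro: poly_fun.add)
qed

section \<open>Matrices with polynomial entries\<close>

definition param_poly_mat ::
  "'v set \<Rightarrow> nat \<Rightarrow> nat \<Rightarrow> nat \<Rightarrow> nat \<Rightarrow> (('v \<Rightarrow> real) \<Rightarrow> sample \<Rightarrow> real mat) \<Rightarrow> bool" where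
  "param_poly_mat V d n nr nc F \<longleftrightarrow> (\<forall>\<theta> \<omega>. F \<theta> \<omega> \<in> carrier_mat nr nc) \<and>
     (\<forall>r<nr. \<forall>c<nc. param_poly V d n (\<lambda>\<theta> \<omega>. F \<theta> \<omega> $$ (r, c)))"

lemma param_poly_mat_mult:
  assumes "param_poly_mat V d n nr m F" "param_poly_mat V d n m nc G"
  shows "param_poly_mat V d n nr nc (\<lambda>\<theta> \<omega>. F \<theta> \<omega> * G \<theta> \<omega>)"
proof -
  have F: "F \<theta> \<omega> \<in> carrier_mat nr m" and G: "G \<theta> \<omega> \<in> carrier_mat m nc" for \<theta> \<omega>
    using assms unfolding param_poly_mat_def by blast+
  have "param_poly V d n (\<lambda>\<theta> \<omega>. (F \<theta> \<omega> * G \<theta> \<omega>) $$ (r, c))" if "r < nr" "c < nc" for r c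
  proof -
    have "param_poly V d n (\<lambda>\<theta> \<omega>. \<Sum>s<m. F \<theta> \<omega> $$ (r, s) * G \<theta> \<omega> $$ (s, c))"
      using that assms by (intro param_poly_sum param_poly_mult) (auto simp: param_poly_mat_def)
    then show ?thesis unfolding mult_mat_entry[OF F G that] .
  qed
  then show ?thesis using mult_carrier_mat[OF F G] unfolding param_poly_mat_def by blast
qed

lemma param_poly_mat_add:
  assumes "param_poly_mat V d n nr nc F" "param_poly_mat V d n nr nc G"
  shows "param_poly_mat V d n nr nc (\<lambda>\<theta> \<omega>. F \<theta> \<omega> + G \<theta> \<omega>)"
proof -
  have G: "G \<theta> \<omega> \<in> carrier_mat nr nc" for \<theta> \<omega>
    using assms unfolding param_poly_mat_def by blast+
  have "param_poly V d n (\<lambda>\<theta> \<omega>. (F \<theta> \<omega> + G \<theta> \<omega>) $$ (r, c))" if "r < nr" "c < nc" for r c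
    using that assms param_poly.add[of V d n "\<lambda>\<theta> \<omega>. F \<theta> \<omega> $$ (r, c)" "\<lambda>\<theta> \<omega>. G \<theta> \<omega> $$ (r, c)"] 
      carrier_matD[OF G] by (simp add: param_poly_mat_def)
  then show ?thesis using assms by (auto simp: param_poly_mat_def)
qed

lemma param_poly_mat_smult:
  assumes "param_poly_mat V d n nr nc F"
  shows "param_poly_mat V d n nr nc (\<lambda>\<theta> \<omega>. a \<cdot>\<^sub>m F \<theta> \<omega>)"
proof -
  have F: "F \<theta> \<omega> \<in> carrier_mat nr nc" for \<theta> \<omega>
    using assms unfolding param_poly_mat_def by blast+
  have "param_poly V d n (\<lambda>\<theta> \<omega>. (a \<cdot>\<^sub>m F \<theta> \<omega>) $$ (r, c))" if "r < nr" "c < nc" for r c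
    using that assms carrier_matD[OF F]
      param_poly_mult[OF param_poly_coeff[OF poly_fun.const[of V a]], of d n "\<lambda>\<theta> \<omega>. F \<theta> \<omega> $$ (r, c)"]
    by (simp add: param_poly_mat_def)
  then show ?thesis using F by (auto simp: param_poly_mat_def)
qed

lemma param_poly_mat_transpose:
  assumes "param_poly_mat V d n nr nc F"
  shows "param_poly_mat V d n nc nr (\<lambda>\<theta> \<omega>. (F \<theta> \<omega>)\<^sup>T)"
proof -
  have F: "F \<theta> \<omega> \<in> carrier_mat nr nc" for \<theta> \<omega>
    using assms unfolding param_poly_mat_def by blast+
  show ?thesis using assms carrier_matD[OF F] by (auto simp: param_poly_mat_def)
qed

type_synonym param_index = "bool \<times> nat \<times> nat \<times> nat"

text \<open>A parameter vector holds the entries of the matrices \<open>A i\<close> at the indices \<open>(True, i, r, c)\<close>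
  and those of \<open>B i\<close> at \<open>(False, i, r, c)\<close>.\<close>

definition param_mat :: "nat \<Rightarrow> (param_index \<Rightarrow> real) \<Rightarrow> bool \<Rightarrow> nat \<Rightarrow> real mat" where
  "param_mat d \<theta> \<tau> i = mat d d (\<lambda>(r, c). \<theta> (\<tau>, i, r, c))"

definition param_indices :: "nat \<Rightarrow> nat \<Rightarrow> param_index set" where
  "param_indices d k = UNIV \<times> {..k} \<times> {..<d} \<times> {..<d}"

lemma param_mat_carrier [simp]: "param_mat d \<theta> \<tau> i \<in> carrier_mat d d"
  by (simp add: param_mat_def)

lemma param_poly_mat_Pmat:
  assumes "i \<le> k"
  shows "param_poly_mat (param_indices d k) d n (Suc d) (Suc d) (\<lambda>\<theta> \<omega>. Pmat d (param_mat d \<theta> \<tau> i))"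
proof -
  have "param_poly (param_indices d k) d n (\<lambda>\<theta> \<omega>. Pmat d (param_mat d \<theta> \<tau> i) $$ (r, c))"
    if "r < Suc d" "c < Suc d" for r c
    using that assms
    by (cases "r < d"; cases "c < d")
       (auto simp: Pmat_def param_mat_def param_indices_def intro!: param_poly_coeff poly_fun.const poly_fun.var)
  then show ?thesis by (simp add: param_poly_mat_def)
qed

lemma param_poly_mat_Qmat:
  assumes "i \<le> k"
  shows "param_poly_mat (param_indices d k) d n (Suc d) (Suc d) (\<lambda>\<theta> \<omega>. Qmat d (param_mat d \<theta> \<tau> i))"
proof -
  have "param_poly (param_indices d k) d n (\<lambda>\<theta> \<omega>. Qmat d (param_mat d \<theta> \<tau> i) $$ (r, c))"
    if "r < Suc d" "c < Suc d" for r c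
    using that assms
    by (cases "r < d"; cases "c < d")
       (auto simp: Qmat_def param_mat_def param_indices_def intro!: param_poly_coeff poly_fun.const poly_fun.var)
  then show ?thesis by (simp add: param_poly_mat_def)
qed

lemma param_poly_inner:
  assumes "j \<in> {1..n+1}"
  shows "param_poly V d n (\<lambda>\<theta> \<omega>. vec d (fst \<omega> j) \<bullet> vec d (snd \<omega>))"
proof -
  have "param_poly V d n (\<lambda>\<theta> \<omega>. \<Sum>i<d. fst \<omega> j i * snd \<omega> i)"
    using assms by (intro param_poly_sum param_poly_mult param_poly_fst param_poly_snd) auto
  then show ?thesis by (simp add: scalar_prod_def atLeast0LessThan)
qed

lemma param_poly_mat_Z0: "param_poly_mat V d n (Suc d) (Suc n) (\<lambda>\<theta> \<omega>. Z0 d n (fst \<omega>) (snd \<omega>))"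
proof -
  have "param_poly V d n (\<lambda>\<theta> \<omega>. Z0 d n (fst \<omega>) (snd \<omega>) $$ (r, c))" if "r < Suc d" "c < Suc n" for r c
    using that param_poly_fst[of "c+1" n r d V] param_poly_inner[of "c+1" n V d]
      param_poly_coeff[OF poly_fun.const[of V 0], of d n]
    by (cases "r < d"; cases "c < n") (auto simp: Z0_def)
  then show ?thesis by (simp add: param_poly_mat_def)
qed

lemma param_poly_mat_const:
  assumes "M \<in> carrier_mat nr nc"
  shows "param_poly_mat V d n nr nc (\<lambda>\<theta> \<omega>. M)"
  using assms by (auto simp: param_poly_mat_def intro!: param_poly_coeff poly_fun.const)

lemma param_poly_mat_Zseq:
  assumes "m \<le> Suc k"
  shows "param_poly_mat (param_indices d k) d n (Suc d) (Suc n)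
           (\<lambda>\<theta> \<omega>. Zseq d n (param_mat d \<theta> True) (param_mat d \<theta> False) (fst \<omega>) (snd \<omega>) m)"
  using assms
proof (induction m)
  case 0
  show ?case using param_poly_mat_Z0 by simp
next
  case (Suc m)
  then have Z: "param_poly_mat (param_indices d k) d n (Suc d) (Suc n)
      (\<lambda>\<theta> \<omega>. Zseq d n (param_mat d \<theta> True) (param_mat d \<theta> False) (fst \<omega>) (snd \<omega>) m)"
    and m: "m \<le> k" by auto
  show ?case
    using param_poly_mat_add[OF Z param_poly_mat_smult[OF param_poly_mat_mult[OF
      param_poly_mat_mult[OF param_poly_mat_mult[OF param_poly_mat_Pmat[OF m] Z] param_poly_mat_const[OF Mmask_carrier]]
      param_poly_mat_mult[OF param_poly_mat_mult[OF param_poly_mat_transpose[OF Z] param_poly_mat_Qmat[OF m]] Z]]]]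
    by (simp add: Let_def)
qed

definition std_loss :: "nat \<Rightarrow> nat \<Rightarrow> nat \<Rightarrow> (param_index \<Rightarrow> real) \<Rightarrow> real" where
  "std_loss d n k \<theta> = icl_loss d n k (1\<^sub>m d) (param_mat d \<theta> True) (param_mat d \<theta> False)"

definition residual ::
  "nat \<Rightarrow> nat \<Rightarrow> nat \<Rightarrow> (nat \<Rightarrow> real mat) \<Rightarrow> (nat \<Rightarrow> real mat) \<Rightarrow> sample \<Rightarrow> real" where
  "residual d n k A B \<omega> = Zseq d n A B (fst \<omega>) (snd \<omega>) (Suc k) $$ (d, n)
            + vec d (snd \<omega>) \<bullet> vec d (fst \<omega> (n+1))"

lemma param_poly_residual:
  "param_poly (param_indices d k) d n
     (\<lambda>\<theta> \<omega>. (residual d n k (param_mat d \<theta> True) (param_mat d \<theta> False) \<omega>)\<^sup>2)"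
proof -
  have "vec d (snd \<omega>) \<bullet> vec d (fst \<omega> (n+1)) = vec d (fst \<omega> (n+1)) \<bullet> vec d (snd \<omega>)" for \<omega> :: sample
    by (intro comm_scalar_prod[of _ d]) auto
  moreover have "param_poly (param_indices d k) d n (\<lambda>\<theta> \<omega>.
      Zseq d n (param_mat d \<theta> True) (param_mat d \<theta> False) (fst \<omega>) (snd \<omega>) (Suc k) $$ (d, n))"
    using param_poly_mat_Zseq[of "Suc k" k d n] unfolding param_poly_mat_def by blast
  moreover have "param_poly (param_indices d k) d n (\<lambda>\<theta> \<omega>. vec d (fst \<omega> (n+1)) \<bullet> vec d (snd \<omega>))"
    by (rule param_poly_inner) simp
  ultimately show ?thesis
    unfolding power2_eq_square residual_def by (simp only: param_poly_mult param_poly.add)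
qed

lemma poly_fun_std_loss: "poly_fun (param_indices d k) (std_loss d n k)"
  using param_poly_expectation[OF param_poly_residual[of d k n]]
  by (simp add: std_loss_def[abs_def] icl_loss_def residual_def)

section \<open>Reduction to identity covariance\<close>

lemma pos_def_mat_factorization:
  assumes "pos_def_mat d Sig"
  shows "\<exists>G H. volume_pair d G H \<and> G * G\<^sup>T = Sig"
proof -
  have Sig: "Sig \<in> carrier_mat d d" "Sig\<^sup>T = Sig"
    and pd: "\<And>v. v \<in> carrier_vec d \<Longrightarrow> v \<noteq> 0\<^sub>v d \<Longrightarrow> v \<bullet> (Sig *\<^sub>v v) > 0"
    using assms by (auto simp: pos_def_mat_def)
  have "\<exists>U. (\<forall>i<d. U i i > 0) \<and> (\<forall>i<d. \<forall>j<i. U i j = 0) \<and>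
             (\<forall>i<d. \<forall>j<d. Sig $$ (i, j) = (\<Sum>m<d. U i m * U j m))"
  proof (rule cholesky)
    show "Sig $$ (i, j) = Sig $$ (j, i)" if "i < d" "j < d" for i j
      using that Sig index_transpose_mat(1)[of i Sig j] by simp
    fix v :: "nat \<Rightarrow> real"
    assume "\<exists>i<d. v i \<noteq> 0"
    then have "vec d v \<noteq> 0\<^sub>v d" by (auto simp: vec_eq_iff)
    from pd[OF _ this] have "0 < vec d v \<bullet> (Sig *\<^sub>v vec d v)" by simp
    also have "\<dots> = (\<Sum>i<d. \<Sum>j<d. v i * Sig $$ (i, j) * v j)"
      using Sig(1) by (simp add: scalar_prod_def atLeast0LessThan sum_distrib_left mult.assoc)
    finally show "0 < (\<Sum>i<d. \<Sum>j<d. v i * Sig $$ (i, j) * v j)" .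
  qed
  then obtain U where U: "\<forall>i<d. U i i > 0" "\<forall>i<d. \<forall>j<i. U i j = 0"
    "\<forall>i<d. \<forall>j<d. Sig $$ (i, j) = (\<Sum>m<d. U i m * U j m)" by (elim exE conjE)
  define G where "G = mat d d (\<lambda>(i, j). U i j)"
  have G: "G \<in> carrier_mat d d" by (simp add: G_def)
  have "G * G\<^sup>T = Sig"
  proof (rule eq_matI)
    fix i j assume "i < dim_row Sig" "j < dim_col Sig"
    then have ij: "i < d" "j < d" using Sig by auto
    have "(G * G\<^sup>T) $$ (i, j) = (\<Sum>m<d. G $$ (i, m) * G\<^sup>T $$ (m, j))"
      using G ij by (intro mult_mat_entry[of _ d _ _ d]) auto
    also have "\<dots> = Sig $$ (i, j)" using U(3) ij by (simp add: G_def)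
    finally show "(G * G\<^sup>T) $$ (i, j) = Sig $$ (i, j)" .
  qed (use G Sig in auto)
  have det: "det G = (\<Prod>i<d. U i i)"
  proof -
    have "det G = prod_list (diag_mat G)"
      using U(2) by (intro det_upper_triangular[OF _ G]) (auto simp: G_def)
    then show ?thesis by (simp add: prod_list_diag_prod G_def atLeast0LessThan)
  qed
  have det_pos: "det G > 0" unfolding det using U(1) by (intro prod_pos) auto
  have abs_det: "\<bar>det G\<bar> = (\<Prod>i<d. \<bar>U i i\<bar>)" unfolding det by (rule abs_prod)
  \<comment> \<open>The adjugate formula gives an explicit two-sided inverse.\<close>
  define H where "H = (1 / det G) \<cdot>\<^sub>m adj_mat G"
  have H: "H \<in> carrier_mat d d" using adj_mat(1)[OF G] by (simp add: H_def)
  have GH: "G * H = 1\<^sub>m d" "H * G = 1\<^sub>m d"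
    using adj_mat[OF G] G det_pos
    by (auto simp: H_def mult_smult_distrib[of G d d _ d] mult_smult_assoc_mat[of _ d d _ d])
  have "leb_scales d (linmap d G) (\<Prod>i<d. \<bar>G $$ (i, i)\<bar>)"
    using U(1,2) by (intro leb_scales_upper_triangular) (auto simp: G_def)
  then have sG: "leb_scales d (linmap d G) \<bar>det G\<bar>" unfolding abs_det by (simp add: G_def)
  have "leb_scales d (linmap d G\<^sup>T) (\<Prod>i<d. \<bar>G\<^sup>T $$ (i, i)\<bar>)"
    using U(1,2) by (intro leb_scales_lower_triangular) (auto simp: G_def)
  then have sGt: "leb_scales d (linmap d G\<^sup>T) \<bar>det G\<bar>" unfolding abs_det by (simp add: G_def)
  \<comment> \<open>The scaling of \<open>H\<^sup>T\<close> is obtained from its inverse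
    \<open>G\<^sup>T\<close>, which is lower triangular; the resulting
    \<open>1 / \<bar>det G\<bar>\<close> is the determinant demanded by
    \<open>volume_pair\<close>.\<close>
  have "H\<^sup>T * G\<^sup>T = 1\<^sub>m d" using G H GH transpose_mult[of G d d H d] by simp
  then have "leb_scales d (linmap d H\<^sup>T) (1 / \<bar>det G\<bar>)"
    using G H by (intro leb_scales_inverse[OF sGt]) auto
  moreover have "\<bar>det G\<bar> * \<bar>det H\<bar> = 1" using det_mult[OF G H] GH by (simp flip: abs_mult)
  then have "1 / \<bar>det G\<bar> = \<bar>det H\<^sup>T\<bar>"
    using det_pos H by (simp add: det_transpose field_simps)
  ultimately have "volume_pair d G H" using G H GH sG by (simp add: volume_pair_def)
  then show ?thesis using \<open>G * G\<^sup>T = Sig\<close> by blast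
qed

definition encode_params :: "(nat \<Rightarrow> real mat) \<Rightarrow> (nat \<Rightarrow> real mat) \<Rightarrow> param_index \<Rightarrow> real" where
  "encode_params A B = (\<lambda>(\<tau>, i, r, c). (if \<tau> then A i else B i) $$ (r, c))"

lemma param_mat_encode_params:
  assumes "A i \<in> carrier_mat d d" "B i \<in> carrier_mat d d"
  shows "param_mat d (encode_params A B) \<tau> i = (if \<tau> then A i else B i)"
  using assms by (intro eq_matI) (auto simp: param_mat_def encode_params_def)

lemma residual_cong:
  assumes "\<And>i. i \<le> k \<Longrightarrow> A i = A' i" "\<And>i. i \<le> k \<Longrightarrow> B i = B' i"
  shows "residual d n k A B = residual d n k A' B'"
proof -
  have "Zseq d n A B xs w (Suc k) = Zseq d n A' B' xs w (Suc k)" for xs w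
    using assms by (intro Zseq_cong) auto
  then show ?thesis by (simp add: residual_def fun_eq_iff del: Zseq.simps)
qed

lemma icl_loss_residual: "icl_loss d n k Sig A B = (\<integral>\<omega>. (residual d n k A B \<omega>)\<^sup>2 \<partial>icl_law d n Sig)"
  by (simp add: icl_loss_def residual_def)

lemma residual_encode_params:
  assumes "\<And>i. i \<le> k \<Longrightarrow> A i \<in> carrier_mat d d" "\<And>i. i \<le> k \<Longrightarrow> B i \<in> carrier_mat d d"
  shows "residual d n k A B
       = residual d n k (param_mat d (encode_params A B) True) (param_mat d (encode_params A B) False)"
  using assms by (intro residual_cong) (simp_all add: param_mat_encode_params)

lemma residual_square_measurable:
  assumes "\<And>i. i \<le> k \<Longrightarrow> A i \<in> carrier_mat d d" "\<And>i. i \<le> k \<Longrightarrow> B i \<in> carrier_mat d d"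
  shows "(\<lambda>\<omega>. (residual d n k A B \<omega>)\<^sup>2) \<in> borel_measurable (icl_law d n (1\<^sub>m d))"
  by (subst residual_encode_params[OF assms])
     (use param_poly_expectation[OF param_poly_residual[of d k n]] in \<open>blast intro: borel_measurable_integrable\<close>)+

text \<open>The residual agrees sample by sample before and after the substitution, so the losses
  differ only in the law, and the law for \<open>G * G\<^sup>T\<close> is the image of the standard
  one.\<close>

lemma icl_loss_linmap:
  assumes vp: "volume_pair d G H"
    and A: "\<And>i. i \<le> k \<Longrightarrow> A i \<in> carrier_mat d d" and B: "\<And>i. i \<le> k \<Longrightarrow> B i \<in> carrier_mat d d"
  shows "icl_loss d n k (G * G\<^sup>T) (\<lambda>i. H\<^sup>T * A i * H) (\<lambda>i. G * B i * H) = icl_loss d n k (1\<^sub>m d) A B"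
proof -
  let ?A = "\<lambda>i. H\<^sup>T * A i * H" and ?B = "\<lambda>i. G * B i * H" and ?N = "mvnormal d (1\<^sub>m d)"
  let ?\<Phi> = "\<lambda>(xs, w). (compose {1..n+1} (linmap d G) xs, linmap d H\<^sup>T w)"
  have c: "G \<in> carrier_mat d d" "H \<in> carrier_mat d d" and HG: "H * G = 1\<^sub>m d"
    using vp by (auto simp: volume_pair_def)
  have [measurable]: "linmap d G \<in> measurable ?N ?N" "linmap d H\<^sup>T \<in> measurable ?N ?N"
    using leb_scalesD(2) vp unfolding volume_pair_def by (auto cong: measurable_cong_sets)
  have \<Phi>: "?\<Phi> \<in> measurable (icl_law d n (1\<^sub>m d)) (icl_law d n (1\<^sub>m d))"
    unfolding icl_law_def mat_inv_one compose_def by measurable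
  have m: "(\<lambda>\<omega>. (residual d n k ?A ?B \<omega>)\<^sup>2) \<in> borel_measurable (icl_law d n (1\<^sub>m d))"
    using c A B by (intro residual_square_measurable) auto
  have "residual d n k ?A ?B (?\<Phi> \<omega>) = residual d n k A B \<omega>" for \<omega>
  proof -
    obtain xs w where \<omega>: "\<omega> = (xs, w)" by (cases \<omega>)
    let ?Z = "Zseq d n A B xs w (Suc k)"
    have Z: "?Z \<in> carrier_mat (Suc d) (Suc n)"
      using A B by (intro Zseq_carrier) auto
    have "Zseq d n ?A ?B (compose {1..n+1} (linmap d G) xs) (linmap d H\<^sup>T w) (Suc k) = Pmat d G * ?Z"
      unfolding Suc_eq_plus1[symmetric, of n] using A B by (intro Zseq_linmap c HG) auto
    moreover have "(Pmat d G * ?Z) $$ (d, n) = (\<Sum>s<Suc d. Pmat d G $$ (d, s) * ?Z $$ (s, n))"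
      using Z Pmat_carrier[OF c(1)] by (intro mult_mat_entry) auto
    \<comment> \<open>The last row of \<open>Pmat d G\<close> is a unit vector, so the prediction in
      the label row does not see \<open>G\<close>.\<close>
    moreover have "\<dots> = ?Z $$ (d, n)" using c by (simp add: Pmat_def del: Zseq.simps)
    moreover have "vec d (linmap d H\<^sup>T w) \<bullet> vec d (linmap d G (xs (n+1))) = vec d w \<bullet> vec d (xs (n+1))"
      using linmap_dual[OF c HG, of "xs (n+1)" w]
      by (metis comm_scalar_prod vec_carrier)
    ultimately show ?thesis
      by (simp add: \<omega> residual_def compose_def del: Zseq.simps)
  qed
  then show ?thesis
    unfolding icl_loss_residual icl_law_linmap[OF vp] using integral_distr[OF \<Phi> m] by simp
qed

lemma icl_loss_std_loss:
  assumes "volume_pair d G H"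
    and "\<And>i. i \<le> k \<Longrightarrow> A i \<in> carrier_mat d d" and "\<And>i. i \<le> k \<Longrightarrow> B i \<in> carrier_mat d d"
  shows "icl_loss d n k (G * G\<^sup>T) (\<lambda>i. H\<^sup>T * A i * H) (\<lambda>i. G * B i * H) = std_loss d n k (encode_params A B)"
proof -
  have "icl_loss d n k (1\<^sub>m d) A B = std_loss d n k (encode_params A B)"
    unfolding std_loss_def icl_loss_residual by (subst residual_encode_params[OF assms(2,3)]) auto
  then show ?thesis using icl_loss_linmap[OF assms] by simp
qed

text \<open>\<open>encode_params\<close> also reads entries beyond the \<open>d\<close> by
  \<open>d\<close> range, about which nothing is known; agreement inside the range suffices.\<close>

lemma std_loss_cong:
  assumes "\<And>\<tau> i r c. r < d \<Longrightarrow> c < d \<Longrightarrow> \<theta> (\<tau>, i, r, c) = \<theta>' (\<tau>, i, r, c)"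
  shows "std_loss d n k \<theta> = std_loss d n k \<theta>'"
proof -
  have "param_mat d \<theta> \<tau> i = param_mat d \<theta>' \<tau> i" for \<tau> i
    using assms by (intro eq_matI) (auto simp: param_mat_def)
  then have "param_mat d \<theta> \<tau> = param_mat d \<theta>' \<tau>" for \<tau> by blast
  then show ?thesis by (simp add: std_loss_def)
qed

lemma std_loss_nonneg: "std_loss d n k \<theta> \<ge> 0"
  by (simp add: std_loss_def icl_loss_def)

section \<open>The gradient at scalar matrices\<close>

definition signed_perm_mat :: "nat \<Rightarrow> (nat \<Rightarrow> nat) \<Rightarrow> (nat \<Rightarrow> real) \<Rightarrow> real mat" where
  "signed_perm_mat d \<sigma> s = mat d d (\<lambda>(p, q). if q = \<sigma> p then s p else 0)"

lemma signed_perm_mat_carrier [simp]: "signed_perm_mat d \<sigma> s \<in> carrier_mat d d"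
  by (simp add: signed_perm_mat_def)

lemma signed_perm_mat_conj:
  assumes A: "A \<in> carrier_mat d d" and \<sigma>: "\<And>p. p < d \<Longrightarrow> \<sigma> p < d" and pq: "p < d" "q < d"
  shows "(signed_perm_mat d \<sigma> s * A * (signed_perm_mat d \<sigma> s)\<^sup>T) $$ (p, q) = s p * s q * A $$ (\<sigma> p, \<sigma> q)"
proof -
  let ?U = "signed_perm_mat d \<sigma> s"
  have UA: "(?U * A) $$ (p, j) = s p * A $$ (\<sigma> p, j)" if "j < d" for j
  proof -
    have "(?U * A) $$ (p, j) = (\<Sum>l<d. ?U $$ (p, l) * A $$ (l, j))"
      using A pq that by (intro mult_mat_entry[of _ d _ _ d]) auto
    also have "\<dots> = s p * A $$ (\<sigma> p, j)"
      using pq \<sigma> by (simp add: signed_perm_mat_def if_distrib[of "\<lambda>z. z * _"] cong: if_cong)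
    finally show ?thesis .
  qed
  have "(?U * A * ?U\<^sup>T) $$ (p, q) = (\<Sum>j<d. (?U * A) $$ (p, j) * ?U\<^sup>T $$ (j, q))"
    by (rule mult_mat_entry[OF mult_carrier_mat[OF signed_perm_mat_carrier A] _ pq]) simp
  also have "\<dots> = (\<Sum>j<d. s p * A $$ (\<sigma> p, j) * (if j = \<sigma> q then s q else 0))"
    using pq UA by (intro sum.cong) (auto simp: signed_perm_mat_def)
  also have "\<dots> = s p * s q * A $$ (\<sigma> p, \<sigma> q)"
    using pq \<sigma> by (simp add: if_distrib[of "\<lambda>z. _ * z"] mult_ac cong: if_cong)
  finally show ?thesis .
qed

lemma linmap_signed_perm_mat:
  assumes "\<And>p. p < d \<Longrightarrow> \<sigma> p < d"
  shows "linmap d (signed_perm_mat d \<sigma> s) v = (\<lambda>p\<in>{..<d}. s p * v (\<sigma> p))"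
  using assms
  by (auto simp: linmap_def signed_perm_mat_def fun_eq_iff restrict_def if_distrib[of "\<lambda>z. z * _"] cong: if_cong)

text \<open>The matrix is orthogonal: its inverse is its transpose, so both volume conditions of the
  pair become the single hypothesis \<open>sc\<close>, and the determinant is 1 or -1.\<close>

lemma signed_perm_volume_pair:
  assumes \<sigma>: "\<And>p. p < d \<Longrightarrow> \<sigma> p < d" "inj_on \<sigma> {..<d}" and s: "\<And>p. s p * s p = 1"
    and sc: "leb_scales d (linmap d (signed_perm_mat d \<sigma> s)) 1"
  shows "volume_pair d (signed_perm_mat d \<sigma> s) (signed_perm_mat d \<sigma> s)\<^sup>T"
    "signed_perm_mat d \<sigma> s * (signed_perm_mat d \<sigma> s)\<^sup>T = 1\<^sub>m d"
proof -
  let ?U = "signed_perm_mat d \<sigma> s"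
  have U: "?U \<in> carrier_mat d d" by simp
  show UU: "?U * ?U\<^sup>T = 1\<^sub>m d"
  proof (rule eq_matI)
    fix p q assume "p < dim_row (1\<^sub>m d :: real mat)" "q < dim_col (1\<^sub>m d :: real mat)"
    then have pq: "p < d" "q < d" by auto
    have "(?U * 1\<^sub>m d * ?U\<^sup>T) $$ (p, q) = s p * s q * 1\<^sub>m d $$ (\<sigma> p, \<sigma> q)"
      using \<sigma>(1) pq by (intro signed_perm_mat_conj) auto
    then have "(?U * ?U\<^sup>T) $$ (p, q) = s p * s q * 1\<^sub>m d $$ (\<sigma> p, \<sigma> q)"
      by (simp only: right_mult_one_mat[OF U])
    then show "(?U * ?U\<^sup>T) $$ (p, q) = 1\<^sub>m d $$ (p, q)"
      unfolding \<open>(?U * ?U\<^sup>T) $$ (p, q) = _\<close> using \<sigma> pq s by (auto simp: inj_on_eq_iff)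
  qed (auto simp: signed_perm_mat_def)
  then have UU': "?U\<^sup>T * ?U = 1\<^sub>m d" by (intro mat_mult_left_right_inverse[of ?U d "?U\<^sup>T"]) auto
  have "det ?U * det ?U = 1"
    using det_mult[of ?U d "?U\<^sup>T"] UU by (simp add: det_transpose[of _ d])
  then have "det ?U = 1 \<or> det ?U = - 1" by (simp add: square_eq_1_iff)
  then have "\<bar>det ?U\<bar> = 1" by auto
  then show "volume_pair d ?U ?U\<^sup>T" using UU UU' sc by (simp add: volume_pair_def)
qed

text \<open>An orthogonal substitution leaves the identity covariance fixed, so the change of
  variables becomes a symmetry of one and the same loss, conjugating all blocks \<open>A i\<close>
  and \<open>B i\<close> by the same matrix.\<close>

lemma std_loss_signed_perm:
  assumes \<sigma>: "\<And>p. p < d \<Longrightarrow> \<sigma> p < d" "inj_on \<sigma> {..<d}" and s: "\<And>p. s p * s p = 1"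
    and sc: "leb_scales d (linmap d (signed_perm_mat d \<sigma> s)) 1"
  shows "std_loss d n k (\<lambda>(\<tau>, i, p, q). s p * s q * \<theta> (\<tau>, i, \<sigma> p, \<sigma> q)) = std_loss d n k \<theta>"
proof -
  let ?U = "signed_perm_mat d \<sigma> s"
  let ?\<theta> = "\<lambda>(\<tau>, i, p, q). s p * s q * \<theta> (\<tau>, i, \<sigma> p, \<sigma> q)"
  have "?U * param_mat d \<theta> \<tau> i * ?U\<^sup>T = param_mat d ?\<theta> \<tau> i" for \<tau> i
  proof (rule eq_matI)
    fix p q assume "p < dim_row (param_mat d ?\<theta> \<tau> i)" "q < dim_col (param_mat d ?\<theta> \<tau> i)"
    then have "p < d" "q < d" by (auto simp: param_mat_def)
    then show "(?U * param_mat d \<theta> \<tau> i * ?U\<^sup>T) $$ (p, q) = param_mat d ?\<theta> \<tau> i $$ (p, q)"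
      using \<sigma>(1) by (subst signed_perm_mat_conj) (auto simp: param_mat_def)
  qed (auto simp: param_mat_def signed_perm_mat_def)
  then show ?thesis
    using icl_loss_linmap[OF signed_perm_volume_pair(1)[OF assms], of k "param_mat d \<theta> True" "param_mat d \<theta> False" n]
    by (simp add: std_loss_def signed_perm_volume_pair(2)[OF assms])
qed

definition diag_params :: "(bool \<times> nat \<Rightarrow> real) \<Rightarrow> param_index \<Rightarrow> real" where
  "diag_params a = (\<lambda>(\<tau>, i, p, q). if p = q then a (\<tau>, i) else 0)"

definition block_params :: "bool \<Rightarrow> nat \<Rightarrow> real mat \<Rightarrow> param_index \<Rightarrow> real" where
  "block_params \<tau> i E = (\<lambda>(\<tau>', i', p, q). if \<tau>' = \<tau> \<and> i' = i then E $$ (p, q) else 0)"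

lemma sum_block_params:
  assumes "i \<le> k"
  shows "(\<Sum>v\<in>param_indices d k. D v * block_params \<tau> i E v) = (\<Sum>p<d. \<Sum>q<d. D (\<tau>, i, p, q) * E $$ (p, q))"
proof -
  have "(\<Sum>v\<in>param_indices d k. D v * block_params \<tau> i E v)
      = (\<Sum>v\<in>{\<tau>} \<times> {i} \<times> {..<d} \<times> {..<d}. D v * block_params \<tau> i E v)"
    using assms by (intro sum.mono_neutral_right) (auto simp: param_indices_def block_params_def split: if_splits)
  also have "\<dots> = (\<Sum>p<d. \<Sum>q<d. D (\<tau>, i, p, q) * E $$ (p, q))"
    unfolding sum.cartesian_product
    by (rule sum.reindex_bij_witness[of _ "\<lambda>(p, q). (\<tau>, i, p, q)" "\<lambda>(_, _, p, q). (p, q)"])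
       (auto simp: block_params_def)
  finally show ?thesis .
qed

text \<open>A linear functional on matrices that is invariant under signed permutations is a
  multiple of the trace. The multiple is read off at entry (0, 0), which exists because
  \<open>d \<ge> 1\<close>.\<close>

lemma std_loss_gradient_scalar:
  assumes "d \<ge> 1"
  shows "\<exists>g. \<forall>\<tau> i E. i \<le> k \<longrightarrow>
    ((\<lambda>t. std_loss d n k (\<lambda>v. diag_params a v + t * block_params \<tau> i E v))
       has_real_derivative g (\<tau>, i) * (\<Sum>p<d. E $$ (p, p))) (at 0)"
proof -
  have "finite (param_indices d k)" by (simp add: param_indices_def)
  from poly_fun_directional_derivative[OF poly_fun_std_loss this] obtain D where
    D: "\<And>e. ((\<lambda>t. std_loss d n k (\<lambda>v. diag_params a v + t * e v))
           has_real_derivative (\<Sum>v\<in>param_indices d k. D v * e v)) (at 0)" by blast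
  define h where "h \<tau> i E = (\<Sum>p<d. \<Sum>q<d. D (\<tau>, i, p, q) * E $$ (p, q))" for \<tau> i E
  have h: "((\<lambda>t. std_loss d n k (\<lambda>v. diag_params a v + t * block_params \<tau> i E v))
           has_real_derivative h \<tau> i E) (at 0)" if "i \<le> k" for \<tau> i E
    using D[of "block_params \<tau> i E"] that by (simp add: sum_block_params h_def)
  have h_unit: "h \<tau> i (unit_entry d r c) = D (\<tau>, i, r, c)" if "r < d" "c < d" for \<tau> i r c
  proof -
    have "h \<tau> i (unit_entry d r c) = (\<Sum>p<d. \<Sum>q<d. if p = r then if q = c then D (\<tau>, i, p, q) else 0 else 0)"
      unfolding h_def unit_entry_def by (intro sum.cong) auto
    also have "\<dots> = (\<Sum>p<d. if p = r then \<Sum>q<d. if q = c then D (\<tau>, i, p, q) else 0 else 0)"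
      by (intro sum.cong) auto
    finally show ?thesis using that by simp
  qed
  \<comment> \<open>The base point consists of scalar blocks and is fixed by the conjugation, so
    only the direction is conjugated; uniqueness of derivatives then equates the two values.\<close>
  have h_conj: "h \<tau> i E = h \<tau> i (mat d d (\<lambda>(p, q). s p * s q * E $$ (\<sigma> p, \<sigma> q)))"
    if "i \<le> k" and \<sigma>: "\<And>p. p < d \<Longrightarrow> \<sigma> p < d" "inj_on \<sigma> {..<d}" and s: "\<And>p. s p * s p = 1"
      and sc: "leb_scales d (linmap d (signed_perm_mat d \<sigma> s)) 1"
    for \<tau> i E \<sigma> and s :: "nat \<Rightarrow> real"
  proof (rule DERIV_unique[OF h[OF \<open>i \<le> k\<close>]])
    let ?E = "mat d d (\<lambda>(p, q). s p * s q * E $$ (\<sigma> p, \<sigma> q))"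
    have "std_loss d n k (\<lambda>v. diag_params a v + t * block_params \<tau> i E v)
        = std_loss d n k (\<lambda>v. diag_params a v + t * block_params \<tau> i ?E v)" for t
    proof -
      let ?\<theta> = "\<lambda>v. diag_params a v + t * block_params \<tau> i E v"
      have "std_loss d n k (\<lambda>(\<tau>', i', p, q). s p * s q * ?\<theta> (\<tau>', i', \<sigma> p, \<sigma> q))
          = std_loss d n k (\<lambda>v. diag_params a v + t * block_params \<tau> i ?E v)"
        using \<sigma> s by (intro std_loss_cong) (auto simp: diag_params_def block_params_def inj_on_eq_iff distrib_left mult_ac)
      then show ?thesis using std_loss_signed_perm[OF \<sigma> s sc, of n k ?\<theta>] by simp
    qed
    then show "((\<lambda>t. std_loss d n k (\<lambda>v. diag_params a v + t * block_params \<tau> i E v))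
           has_real_derivative h \<tau> i ?E) (at 0)"
      using h[OF \<open>i \<le> k\<close>, of \<tau> ?E] by simp
  qed
  have off_diag: "D (\<tau>, i, r, c) = 0" if i: "i \<le> k" and rc: "r < d" "c < d" "r \<noteq> c" for \<tau> i r c
  proof -
    \<comment> \<open>Flipping the sign of coordinate \<open>r\<close> alone negates the unit
      direction at (r, c), so its coefficient equals its own negative.\<close>
    define s where "s p = (if p = r then -1 else 1 :: real)" for p
    have "leb_scales d (linmap d (signed_perm_mat d id s)) 1"
    proof (rule leb_scales_cong[OF leb_scales_negate[OF rc(1)]])
      show "v(r := - v r) = linmap d (signed_perm_mat d id s) v" if "v \<in> extensional {..<d}" for v :: "nat \<Rightarrow> real"
        using that rc by (auto simp: linmap_signed_perm_mat s_def fun_eq_iff extensional_def)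
    qed
    from h_conj[OF i _ _ _ this, of \<tau> "unit_entry d r c"]
    have "h \<tau> i (unit_entry d r c) = h \<tau> i (mat d d (\<lambda>(p, q). s p * s q * unit_entry d r c $$ (p, q)))"
      by (simp add: s_def)
    also have "\<dots> = - h \<tau> i (unit_entry d r c)"
      unfolding h_def sum_negf[symmetric] using rc
      by (intro sum.cong) (auto simp: unit_entry_def s_def)
    finally show ?thesis using h_unit rc by simp
  qed
  have on_diag: "D (\<tau>, i, r, r) = D (\<tau>, i, 0, 0)" if i: "i \<le> k" and r: "r < d" for \<tau> i r
  proof (cases "r = 0")
    case False
    \<comment> \<open>With \<open>\<sigma>\<close> below this is the quarter turn in the plane of
      coordinates 0 and \<open>r\<close>; it carries the unit direction at (r, r) to the one at (0,
      0), where the sign occurs squared.\<close>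
    define s where "s p = (if p = r then -1 else 1 :: real)" for p
    define \<sigma> where "\<sigma> p = (if p = r then 0 else if p = 0 then r else p)" for p
    have \<sigma>: "\<And>p. p < d \<Longrightarrow> \<sigma> p < d" "inj_on \<sigma> {..<d}"
      using r assms by (auto simp: \<sigma>_def inj_on_def)
    have "leb_scales d (linmap d (signed_perm_mat d \<sigma> s)) 1"
    proof (rule leb_scales_cong[OF leb_scales_rotate[of r d 0]])
      show "v(r := - v 0, 0 := v r) = linmap d (signed_perm_mat d \<sigma> s) v" if "v \<in> extensional {..<d}" for v :: "nat \<Rightarrow> real"
        using that r assms False \<sigma>(1) by (auto simp: linmap_signed_perm_mat s_def \<sigma>_def fun_eq_iff extensional_def)
    qed (use r assms False in auto)
    from h_conj[OF i \<sigma> _ this, of \<tau> "unit_entry d r r"]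
    have "h \<tau> i (unit_entry d r r) = h \<tau> i (mat d d (\<lambda>(p, q). s p * s q * unit_entry d r r $$ (\<sigma> p, \<sigma> q)))"
      by (simp add: s_def)
    also have "mat d d (\<lambda>(p, q). s p * s q * unit_entry d r r $$ (\<sigma> p, \<sigma> q)) = unit_entry d 0 0"
      using False r by (intro eq_matI) (auto simp: unit_entry_def s_def \<sigma>_def)
    finally show ?thesis using h_unit r assms by simp
  qed simp
  have "h \<tau> i E = D (\<tau>, i, 0, 0) * (\<Sum>p<d. E $$ (p, p))" if i: "i \<le> k" for \<tau> i E
  proof -
    have "h \<tau> i E = (\<Sum>p<d. \<Sum>q<d. if q = p then D (\<tau>, i, 0, 0) * E $$ (p, p) else 0)"
      unfolding h_def
    proof (intro sum.cong refl)
      fix p q assume "p \<in> {..<d}" "q \<in> {..<d}"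
      then show "D (\<tau>, i, p, q) * E $$ (p, q) = (if q = p then D (\<tau>, i, 0, 0) * E $$ (p, p) else 0)"
        using off_diag[OF i, of p q \<tau>] on_diag[OF i, of p \<tau>] by (cases "p = q") auto
    qed
    then show ?thesis by (simp add: sum_distrib_left)
  qed
  then show ?thesis using h by (intro exI[of _ "\<lambda>(\<tau>, i). D (\<tau>, i, 0, 0)"]) simp
qed

lemma continuous_on_std_loss_diag: "continuous_on UNIV (\<lambda>a. std_loss d n k (diag_params a))"
proof -
  have "continuous_on UNIV (\<lambda>a. diag_params a v)" for v
  proof (cases v)
    case (fields \<tau> i p q)
    then show ?thesis
      by (cases "p = q") (simp_all add: diag_params_def continuous_on_product_coordinates)
  qed
  then have "continuous_on UNIV diag_params"
    by (rule continuous_on_coordinatewise_then_product)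
  then show ?thesis
    by (rule continuous_on_compose2[OF poly_fun_continuous[OF poly_fun_std_loss]]) auto
qed

text \<open>Pulls a perturbation \<open>E\<close> back to normalized coordinates:
  \<open>P' * E * Q'\<close> is the direction that conjugation returns to \<open>E\<close>. It
  serves the \<open>A\<close> blocks with \<open>H\<^sup>T\<close>, \<open>H\<close> and the
  \<open>B\<close> blocks with \<open>G\<close>, \<open>H\<close> in the roles of \<open>P\<close>,
  \<open>Q\<close>.\<close>

lemma mult_affine_conj:
  fixes P :: "real mat"
  assumes "P \<in> carrier_mat d d" "Q \<in> carrier_mat d d" "P' \<in> carrier_mat d d" "Q' \<in> carrier_mat d d"
    "E \<in> carrier_mat d d" "P * P' = 1\<^sub>m d" "Q' * Q = 1\<^sub>m d"
  shows "P * (a \<cdot>\<^sub>m 1\<^sub>m d + t \<cdot>\<^sub>m (P' * E * Q')) * Q = a \<cdot>\<^sub>m (P * Q) + t \<cdot>\<^sub>m E"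
proof -
  let ?F = "P' * E * Q'"
  have F: "?F \<in> carrier_mat d d" using assms by auto
  have "P * ?F = P * (P' * (E * Q'))" using assms by simp
  also have "\<dots> = P * P' * (E * Q')" using assms by (intro assoc_mult_mat[symmetric]) auto
  also have "\<dots> = E * Q'" unfolding assms(6) using assms by (intro left_mult_one_mat) auto
  finally have "P * ?F * Q = E * Q' * Q" by simp
  also have "\<dots> = E * (Q' * Q)" using assms by (intro assoc_mult_mat) auto
  finally have PFQ: "P * ?F * Q = E" using assms by simp
  have "P * (a \<cdot>\<^sub>m 1\<^sub>m d + t \<cdot>\<^sub>m ?F) = P * (a \<cdot>\<^sub>m 1\<^sub>m d) + P * (t \<cdot>\<^sub>m ?F)"
    using assms F by (intro mult_add_distrib_mat) auto
  also have "\<dots> = a \<cdot>\<^sub>m P + t \<cdot>\<^sub>m (P * ?F)"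
    using assms F mult_smult_distrib[OF assms(1) F] mult_smult_distrib[OF assms(1) one_carrier_mat]
    by simp
  finally have "P * (a \<cdot>\<^sub>m 1\<^sub>m d + t \<cdot>\<^sub>m ?F) * Q = (a \<cdot>\<^sub>m P + t \<cdot>\<^sub>m (P * ?F)) * Q" by simp
  also have "\<dots> = a \<cdot>\<^sub>m P * Q + t \<cdot>\<^sub>m (P * ?F) * Q"
    using assms F by (intro add_mult_distrib_mat) auto
  also have "\<dots> = a \<cdot>\<^sub>m (P * Q) + t \<cdot>\<^sub>m (P * ?F * Q)"
    using mult_smult_assoc_mat[OF assms(1,2)] mult_smult_assoc_mat[OF mult_carrier_mat[OF assms(1) F] assms(2)]
    by simp
  finally show ?thesis by (simp only: PFQ)
qed

text \<open>Cyclicity of the trace. In the \<open>A\<close> blocks the product \<open>Q * P\<close>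
  is the covariance \<open>G * G\<^sup>T\<close>, in the \<open>B\<close> blocks it is
  \<open>G * H\<close>, the identity.\<close>

lemma trace_unit_entry_conj:
  assumes P: "P \<in> carrier_mat d d" and Q: "Q \<in> carrier_mat d d" and rc: "r < d" "c < d"
  shows "(\<Sum>p<d. (P * unit_entry d r c * Q) $$ (p, p)) = (Q * P) $$ (c, r)"
proof -
  let ?E = "unit_entry d r c"
  have E: "?E \<in> carrier_mat d d" by (simp add: unit_entry_def)
  have PE: "(P * ?E) $$ (p, j) = (if j = c then P $$ (p, r) else 0)" if "p < d" "j < d" for p j
  proof -
    have "(P * ?E) $$ (p, j) = (\<Sum>l<d. P $$ (p, l) * ?E $$ (l, j))"
      by (rule mult_mat_entry[OF P E that])
    also have "\<dots> = (\<Sum>l<d. if l = r then if j = c then P $$ (p, r) else 0 else 0)"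
      using that by (intro sum.cong) (auto simp: unit_entry_def)
    finally show ?thesis using rc by simp
  qed
  have "(P * ?E * Q) $$ (p, p) = Q $$ (c, p) * P $$ (p, r)" if "p < d" for p
  proof -
    have "(P * ?E * Q) $$ (p, p) = (\<Sum>j<d. (P * ?E) $$ (p, j) * Q $$ (j, p))"
      using P E Q that by (intro mult_mat_entry[of _ d]) auto
    also have "\<dots> = (\<Sum>j<d. if j = c then Q $$ (c, p) * P $$ (p, r) else 0)"
      using that PE by (intro sum.cong) auto
    finally show ?thesis using rc by simp
  qed
  then show ?thesis using mult_mat_entry[OF Q P rc(2,1)] by simp
qed

section \<open>The infimum\<close>

lemma add_zero_smult_mat:
  fixes X E :: "real mat"
  assumes "X \<in> carrier_mat d d" "E \<in> carrier_mat d d"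
  shows "X + 0 \<cdot>\<^sub>m E = X"
  using assms by (intro eq_matI) auto

text \<open>Multiples of the inverse covariance are exactly what scalar matrices become under
  \<open>A\<close> to \<open>H\<^sup>T * A * H\<close>, so a perturbed point of the family
  corresponds to a perturbed point of the scalar family.\<close>

lemma icl_loss_perturb_A:
  assumes vp: "volume_pair d G H" and E: "E \<in> carrier_mat d d"
  defines "S \<equiv> mat_inv d (G * G\<^sup>T)"
  shows "icl_loss d n k (G * G\<^sup>T) ((\<lambda>j. a (True, j) \<cdot>\<^sub>m S)(i := a (True, i) \<cdot>\<^sub>m S + t \<cdot>\<^sub>m E))
           (\<lambda>j. a (False, j) \<cdot>\<^sub>m 1\<^sub>m d)
       = std_loss d n k (\<lambda>v. diag_params a v + t * block_params True i (G\<^sup>T * E * G) v)"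
proof -
  have c: "G \<in> carrier_mat d d" "H \<in> carrier_mat d d" and GH: "G * H = 1\<^sub>m d"
    using vp by (auto simp: volume_pair_def)
  have HG: "H\<^sup>T * G\<^sup>T = 1\<^sub>m d" using volume_pair_transpose[OF vp] by (simp add: volume_pair_def)
  have S: "S = H\<^sup>T * H" unfolding S_def by (rule mat_inv_mult_transpose[OF vp])
  have Sc: "S \<in> carrier_mat d d" using c by (simp add: S)
  define A where "A j = a (True, j) \<cdot>\<^sub>m 1\<^sub>m d + (if j = i then t else 0) \<cdot>\<^sub>m (G\<^sup>T * E * G)" for j
  define B where "B j = a (False, j) \<cdot>\<^sub>m 1\<^sub>m d" for j
  have A: "H\<^sup>T * A j * H = ((\<lambda>j. a (True, j) \<cdot>\<^sub>m S)(i := a (True, i) \<cdot>\<^sub>m S + t \<cdot>\<^sub>m E)) j" for j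
    using mult_affine_conj[of "H\<^sup>T" d H "G\<^sup>T" G E "a (True, j)" "if j = i then t else 0"] c E HG GH Sc
    by (auto simp: A_def S[symmetric] add_zero_smult_mat[of _ d])
  have B: "G * B j * H = a (False, j) \<cdot>\<^sub>m 1\<^sub>m d" for j
    using c GH mult_smult_distrib[OF c(1) one_carrier_mat] mult_smult_assoc_mat[OF c] by (simp add: B_def)
  have "icl_loss d n k (G * G\<^sup>T) (\<lambda>j. H\<^sup>T * A j * H) (\<lambda>j. G * B j * H) = std_loss d n k (encode_params A B)"
    using c E by (intro icl_loss_std_loss[OF vp]) (auto simp: A_def B_def)
  also have "\<dots> = std_loss d n k (\<lambda>v. diag_params a v + t * block_params True i (G\<^sup>T * E * G) v)"
  proof (rule std_loss_cong)
    fix \<tau> j r s assume "r < d" "s < d"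
    then show "encode_params A B (\<tau>, j, r, s)
        = diag_params a (\<tau>, j, r, s) + t * block_params True i (G\<^sup>T * E * G) (\<tau>, j, r, s)"
      using c E by (cases \<tau>) (simp_all add: encode_params_def A_def B_def diag_params_def block_params_def)
  qed
  finally show ?thesis unfolding A B .
qed

lemma icl_loss_perturb_B:
  assumes vp: "volume_pair d G H" and E: "E \<in> carrier_mat d d"
  defines "S \<equiv> mat_inv d (G * G\<^sup>T)"
  shows "icl_loss d n k (G * G\<^sup>T) (\<lambda>j. a (True, j) \<cdot>\<^sub>m S)
           ((\<lambda>j. a (False, j) \<cdot>\<^sub>m 1\<^sub>m d)(i := a (False, i) \<cdot>\<^sub>m 1\<^sub>m d + t \<cdot>\<^sub>m E))
       = std_loss d n k (\<lambda>v. diag_params a v + t * block_params False i (H * E * G) v)"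
proof -
  have c: "G \<in> carrier_mat d d" "H \<in> carrier_mat d d" and GH: "G * H = 1\<^sub>m d"
    using vp by (auto simp: volume_pair_def)
  have S: "S = H\<^sup>T * H" unfolding S_def by (rule mat_inv_mult_transpose[OF vp])
  define A where "A j = a (True, j) \<cdot>\<^sub>m 1\<^sub>m d" for j
  define B where "B j = a (False, j) \<cdot>\<^sub>m 1\<^sub>m d + (if j = i then t else 0) \<cdot>\<^sub>m (H * E * G)" for j
  have Ht: "H\<^sup>T \<in> carrier_mat d d" using c by simp
  have A: "H\<^sup>T * A j * H = a (True, j) \<cdot>\<^sub>m S" for j
    using c mult_smult_distrib[OF Ht one_carrier_mat] mult_smult_assoc_mat[OF Ht c(2)] by (simp add: A_def S)
  have B: "G * B j * H = ((\<lambda>j. a (False, j) \<cdot>\<^sub>m 1\<^sub>m d)(i := a (False, i) \<cdot>\<^sub>m 1\<^sub>m d + t \<cdot>\<^sub>m E)) j" for j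
    using mult_affine_conj[of G d H H G E "a (False, j)" "if j = i then t else 0"] c E GH
    by (auto simp: B_def add_zero_smult_mat[of _ d])
  have "icl_loss d n k (G * G\<^sup>T) (\<lambda>j. H\<^sup>T * A j * H) (\<lambda>j. G * B j * H) = std_loss d n k (encode_params A B)"
    using c E by (intro icl_loss_std_loss[OF vp]) (auto simp: A_def B_def)
  also have "\<dots> = std_loss d n k (\<lambda>v. diag_params a v + t * block_params False i (H * E * G) v)"
  proof (rule std_loss_cong)
    fix \<tau> j r s assume "r < d" "s < d"
    then show "encode_params A B (\<tau>, j, r, s)
        = diag_params a (\<tau>, j, r, s) + t * block_params False i (H * E * G) (\<tau>, j, r, s)"
      using c E by (cases \<tau>) (simp_all add: encode_params_def A_def B_def diag_params_def block_params_def)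
  qed
  finally show ?thesis unfolding A B .
qed

lemma unit_entry_carrier [simp]: "unit_entry d r c \<in> carrier_mat d d"
  by (simp add: unit_entry_def)

lemma frob_sq_mat_grad:
  "frob_sq (mat_grad d F X) = (\<Sum>r<d. \<Sum>c<d. (deriv (\<lambda>t. F (X + t \<cdot>\<^sub>m unit_entry d r c)) 0)\<^sup>2)"
  by (simp add: frob_sq_def mat_grad_def)

lemma icl_loss_almost_critical:
  assumes "d \<ge> 1" and Sig: "pos_def_mat d Sig" and "e > 0"
  shows "\<exists>a. (\<Sum>i\<le>k.
      frob_sq (mat_grad d (\<lambda>X. icl_loss d n k Sig ((\<lambda>j. a (True, j) \<cdot>\<^sub>m mat_inv d Sig)(i := X))
        (\<lambda>j. a (False, j) \<cdot>\<^sub>m 1\<^sub>m d)) (a (True, i) \<cdot>\<^sub>m mat_inv d Sig))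
    + frob_sq (mat_grad d (\<lambda>X. icl_loss d n k Sig (\<lambda>j. a (True, j) \<cdot>\<^sub>m mat_inv d Sig)
        ((\<lambda>j. a (False, j) \<cdot>\<^sub>m 1\<^sub>m d)(i := X))) (a (False, i) \<cdot>\<^sub>m 1\<^sub>m d))) < e"
proof -
  obtain G H where vp: "volume_pair d G H" and GG: "G * G\<^sup>T = Sig"
    using pos_def_mat_factorization[OF Sig] by blast
  have c: "G \<in> carrier_mat d d" "H \<in> carrier_mat d d" and GH: "G * H = 1\<^sub>m d"
    using vp by (auto simp: volume_pair_def)
  \<comment> \<open>The trace coefficient depends on the base point \<open>a\<close>; choice makes
    it a function of \<open>a\<close>, as required of the partial derivatives in
    \<open>approx_critical_point\<close>.\<close>
  have "\<forall>a. \<exists>g. \<forall>\<tau> i E. i \<le> k \<longrightarrow>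
      ((\<lambda>t. std_loss d n k (\<lambda>v. diag_params a v + t * block_params \<tau> i E v))
         has_real_derivative g (\<tau>, i) * (\<Sum>p<d. E $$ (p, p))) (at 0)"
    using std_loss_gradient_scalar[OF \<open>d \<ge> 1\<close>] by (intro allI)
  from choice[OF this] obtain g where "\<forall>a \<tau> i E. i \<le> k \<longrightarrow>
      ((\<lambda>t. std_loss d n k (\<lambda>v. diag_params a v + t * block_params \<tau> i E v))
         has_real_derivative g a (\<tau>, i) * (\<Sum>p<d. E $$ (p, p))) (at 0)"
    by (elim exE)
  note g = this[rule_format]
  \<comment> \<open>The squared Frobenius norm of \<open>Sig\<close>, by which the squared trace
    coefficient is multiplied in the \<open>A\<close> blocks; in the \<open>B\<close> blocks the
    factor is that of the identity, \<open>d\<close>.\<close>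
  define S where "S = (\<Sum>r<d. \<Sum>s<d. (Sig $$ (s, r))\<^sup>2)"
  have S: "S \<ge> 0" unfolding S_def by (intro sum_nonneg) auto
  \<comment> \<open>Partial derivatives of the restricted loss are \<open>d\<close> times the trace
    coefficients, and the full gradient costs at most \<open>S + d\<close> per squared coefficient;
    \<open>e'\<close> converts one bound into the other.\<close>
  define e' where "e' = e * (real d)\<^sup>2 / (S + real d)"
  have e': "e' > 0" using S \<open>e > 0\<close> \<open>d \<ge> 1\<close> by (simp add: e'_def add_nonneg_pos)
  let ?I = "(UNIV :: bool set) \<times> {..k}"
  have "\<exists>a. (\<Sum>v\<in>?I. (g a v * real d)\<^sup>2) < e'"
  proof (rule approx_critical_point[OF _ continuous_on_std_loss_diag _ _ e', of _ d n k])
    fix a and v :: "bool \<times> nat"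
    assume v: "v \<in> ?I"
    obtain \<tau> i where vi: "v = (\<tau>, i)" by (cases v)
    \<comment> \<open>Moving one scalar parameter means moving its block along the identity, whose
      trace \<open>d\<close> is the factor in the partial derivative.\<close>
    have "std_loss d n k (diag_params (a(v := a v + t)))
        = std_loss d n k (\<lambda>w. diag_params a w + t * block_params \<tau> i (1\<^sub>m d) w)" for t
      by (rule std_loss_cong) (auto simp: diag_params_def block_params_def vi)
    then show "((\<lambda>t. std_loss d n k (diag_params (a(v := a v + t)))) has_real_derivative g a v * real d) (at 0)"
      using g[of i a \<tau> "1\<^sub>m d"] v vi by simp
  qed (auto simp: std_loss_nonneg)
  then obtain a where a: "(\<Sum>v\<in>?I. (g a v * real d)\<^sup>2) < e'" ..
  let ?A = "\<lambda>j. a (True, j) \<cdot>\<^sub>m mat_inv d Sig" and ?B = "\<lambda>j. a (False, j) \<cdot>\<^sub>m 1\<^sub>m d"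
  have dA: "deriv (\<lambda>t. icl_loss d n k Sig (?A(i := ?A i + t \<cdot>\<^sub>m unit_entry d r s)) ?B) 0
      = g a (True, i) * Sig $$ (s, r)" if "i \<le> k" "r < d" "s < d" for i r s
  proof (rule DERIV_imp_deriv)
    have "(\<Sum>p<d. (G\<^sup>T * unit_entry d r s * G) $$ (p, p)) = Sig $$ (s, r)"
      using trace_unit_entry_conj[of "G\<^sup>T" d G r s] c that GG by simp
    then show "((\<lambda>t. icl_loss d n k Sig (?A(i := ?A i + t \<cdot>\<^sub>m unit_entry d r s)) ?B)
        has_real_derivative g a (True, i) * Sig $$ (s, r)) (at 0)"
      using g[OF \<open>i \<le> k\<close>, of a True "G\<^sup>T * unit_entry d r s * G"]
        icl_loss_perturb_A[OF vp unit_entry_carrier, of n k a i _ r s] by (simp add: GG)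
  qed
  have dB: "deriv (\<lambda>t. icl_loss d n k Sig ?A (?B(i := ?B i + t \<cdot>\<^sub>m unit_entry d r s))) 0
      = g a (False, i) * (if s = r then 1 else 0)" if "i \<le> k" "r < d" "s < d" for i r s
  proof (rule DERIV_imp_deriv)
    have "(\<Sum>p<d. (H * unit_entry d r s * G) $$ (p, p)) = (if s = r then 1 else 0)"
      using trace_unit_entry_conj[of H d G r s] c that GH by simp
    then show "((\<lambda>t. icl_loss d n k Sig ?A (?B(i := ?B i + t \<cdot>\<^sub>m unit_entry d r s)))
        has_real_derivative g a (False, i) * (if s = r then 1 else 0)) (at 0)"
      using g[OF \<open>i \<le> k\<close>, of a False "H * unit_entry d r s * G"]
        icl_loss_perturb_B[OF vp unit_entry_carrier, of n k a i _ r s] by (simp add: GG)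
  qed
  have "(\<Sum>i\<le>k. frob_sq (mat_grad d (\<lambda>X. icl_loss d n k Sig (?A(i := X)) ?B) (?A i))
        + frob_sq (mat_grad d (\<lambda>X. icl_loss d n k Sig ?A (?B(i := X))) (?B i)))
      = (\<Sum>i\<le>k. (g a (True, i))\<^sup>2 * S + (g a (False, i))\<^sup>2 * real d)"
  proof (intro sum.cong refl arg_cong2[where f = "(+)"])
    fix i assume "i \<in> {..k}"
    then have i: "i \<le> k" by simp
    show "frob_sq (mat_grad d (\<lambda>X. icl_loss d n k Sig (?A(i := X)) ?B) (?A i)) = (g a (True, i))\<^sup>2 * S"
      unfolding frob_sq_mat_grad S_def using dA[OF i]
      by (simp add: power_mult_distrib sum_distrib_left)
    have "frob_sq (mat_grad d (\<lambda>X. icl_loss d n k Sig ?A (?B(i := X))) (?B i))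
        = (\<Sum>r<d. \<Sum>s<d. if s = r then (g a (False, i))\<^sup>2 else 0)"
      unfolding frob_sq_mat_grad using dB[OF i] by (intro sum.cong refl) auto
    then show "frob_sq (mat_grad d (\<lambda>X. icl_loss d n k Sig ?A (?B(i := X))) (?B i)) = (g a (False, i))\<^sup>2 * real d"
      by simp
  qed
  also have "\<dots> \<le> (\<Sum>i\<le>k. ((g a (True, i))\<^sup>2 + (g a (False, i))\<^sup>2) * (S + real d))"
    using S by (intro sum_mono) (simp add: algebra_simps)
  also have "\<dots> = (\<Sum>v\<in>?I. (g a v)\<^sup>2) * (S + real d)"
  proof -
    have "(\<Sum>v\<in>?I. (g a v)\<^sup>2) = (\<Sum>\<tau>\<in>UNIV. \<Sum>i\<le>k. (g a (\<tau>, i))\<^sup>2)"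
      by (simp add: sum.cartesian_product)
    then show ?thesis by (simp add: UNIV_bool sum.distrib add.commute flip: sum_distrib_right)
  qed
  also have "\<dots> = (\<Sum>v\<in>?I. (g a v * real d)\<^sup>2) * ((S + real d) / (real d)\<^sup>2)"
    using \<open>d \<ge> 1\<close> by (simp add: power_mult_distrib sum_distrib_right[symmetric])
  also have "\<dots> < e' * ((S + real d) / (real d)\<^sup>2)"
    using a S \<open>d \<ge> 1\<close> by (intro mult_strict_right_mono) (auto intro!: divide_pos_pos add_nonneg_pos)
  also have "\<dots> = e" using S \<open>d \<ge> 1\<close> by (simp add: e'_def add_nonneg_eq_0_iff)
  finally show ?thesis by (rule exI[of _ a])
qed

theorem theorem4:
  fixes d n k :: nat and Sig :: "real mat"
  assumes "d \<ge> 1" and "n \<ge> 1"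
    and "pos_def_mat d Sig"
  shows "(INF AB \<in> {(A, B). \<forall>i\<le>k. A i \<in> carrier_mat d d \<and> B i \<in> carrier_mat d d \<and>
                               (\<exists>a b :: real. A i = a \<cdot>\<^sub>m mat_inv d Sig \<and> B i = b \<cdot>\<^sub>m 1\<^sub>m d)}.
            (\<Sum>i\<le>k. frob_sq (mat_grad d (\<lambda>X. icl_loss d n k Sig ((fst AB)(i := X)) (snd AB)) (fst AB i))
                  + frob_sq (mat_grad d (\<lambda>X. icl_loss d n k Sig (fst AB) ((snd AB)(i := X))) (snd AB i))))
         = 0"
    (is "(INF AB\<in>?S. ?f AB) = 0")
proof -
  obtain G H where vp: "volume_pair d G H" and GG: "G * G\<^sup>T = Sig"
    using pos_def_mat_factorization[OF assms(3)] by blast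
  have inv: "mat_inv d Sig \<in> carrier_mat d d"
    using mat_inv_mult_transpose[OF vp] vp GG by (auto simp: volume_pair_def)
  have nonneg: "?f AB \<ge> 0" for AB
    by (intro sum_nonneg add_nonneg_nonneg) (auto simp: frob_sq_def intro!: sum_nonneg)
  \<comment> \<open>The infimum of reals behaves as expected only for a nonempty set bounded below,
    so both properties are established.\<close>
  then have bdd: "bdd_below (?f ` ?S)" by (intro bdd_belowI2[of _ 0])
  have small: "(INF AB\<in>?S. ?f AB) < e" if e: "e > 0" for e
  proof -
    obtain a where a: "?f (\<lambda>j. a (True, j) \<cdot>\<^sub>m mat_inv d Sig, \<lambda>j. a (False, j) \<cdot>\<^sub>m 1\<^sub>m d) < e"
      using icl_loss_almost_critical[OF assms(1,3) e, where n = n and k = k] by auto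
    have "(\<lambda>j. a (True, j) \<cdot>\<^sub>m mat_inv d Sig, \<lambda>j. a (False, j) \<cdot>\<^sub>m 1\<^sub>m d) \<in> ?S"
      using inv by auto
    from cINF_lower[OF bdd this] a show ?thesis by linarith
  qed
  have "(\<lambda>_. 0 \<cdot>\<^sub>m mat_inv d Sig, \<lambda>_. 0 \<cdot>\<^sub>m 1\<^sub>m d) \<in> ?S" using inv by auto
  then have "?S \<noteq> {}" by (metis empty_iff)
  then have "(INF AB\<in>?S. ?f AB) \<ge> 0" by (rule cINF_greatest) (rule nonneg)
  \<comment> \<open>A positive infimum could itself be taken as the bound \<open>e\<close>, making
    it strictly smaller than itself.\<close>
  then show ?thesis using small[of "INF AB\<in>?S. ?f AB"] by fastforce
qed

end
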